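(* Let $A$ be a finite-dimensional vector space over $\mathbf{k}$, let $(A,\circ)$ be a Novikov algebra and $(A,\Delta)$ a Novikov coalgebra. Let $\cdot$ denote the multiplication on the dual space $A^*$ induced by $\Delta$, i.e. $\langle f\cdot g,a\rangle=\langle f\otimes g,\Delta(a)\rangle$. Then the following conditions are equivalent. (a) There is a Manin triple $(A\oplus A^*,(A,\circ),(A^*,\cdot))$ of Novikov algebras. (b) $(A,A^*,L_{A,\star}^*,-R_A^*,L_{A^*,\star}^*,-R_{A^*}^* )$ is a matched pair of Novikov algebras. (c) $(A,\circ,\Delta)$ is a Novikov bialgebra.
   Context: $\mathbf{k}$ is a field of characteristic zero; $\tau(x\otimes y)=y\otimes x$. A Novikov algebra $(A,\circ)$: $(a\circ b)\circ c-a\circ(b\circ c)=(b\circ a)\circ c-b\circ(a\circ c)$ and $(a\circ b)\circ c=(a\circ c)\circ b$. A Novikov coalgebra $(A,\Delta)$: $\Delta:A\to A\otimes A$ linear with $(\mathrm{id}\otimes\Delta)\Delta-(\tau\otimes\mathrm{id})(\mathrm{id}\otimes\Delta)\Delta=(\Delta\otimes\mathrm{id})\Delta-(\tau\otimes\mathrm{id})(\Delta\otimes\mathrm{id})\Delta$ and $(\tau\otimes\mathrm{id})(\mathrm{id}\otimes\Delta)\tau\Delta=(\Delta\otimes\mathrm{id})\Delta$. In this case $(A^*,\cdot)$ is a Novikov algebra. For a Novikov algebra $(A,\circ)$: $a\star b=a\circ b+b\circ a$, $L_A(a)b=a\circ b$, $R_A(a)b=b\circ a$, $L_{A,\star}=L_A+R_A$;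 likewise for $(A^*,\cdot)$. For $\varphi:A\to\mathrm{End}(V)$, $\varphi^*:A\to\mathrm{End}(V^* )$ is given by $\langle\varphi^*(a)f,v\rangle=-\langle f,\varphi(a)v\rangle$. Thus $L_{A,\star}^*=L_A^*+R_A^*$, acting on $A^*$; and $L_{A^*,\star}^*=L_{A^*}^*+R_{A^*}^*$, $R_{A^*}^*$ act on $A=(A^* )^*$. A Novikov bialgebra is $(A,\circ,\Delta)$ with $(A,\circ)$ a Novikov algebra, $(A,\Delta)$ a Novikov coalgebra and, for all $a,b\in A$, $$\Delta(a\circ b)=(R_A(b)\otimes\mathrm{id})\Delta(a)+(\mathrm{id}\otimes L_{A,\star}(a))(\Delta(b)+\tau\Delta(b)),$$ $$(L_{A,\star}(a)\otimes\mathrm{id})\Delta(b)-(\mathrm{id}\otimes L_{A,\star}(a))\tau\Delta(b)=(L_{A,\star}(b)\otimes\mathrm{id})\Delta(a)-(\mathrm{id}\otimes L_{A,\star}(b))\tau\Delta(a),$$ $$(\mathrm{id}\otimes R_A(a)-R_A(a)\otimes\mathrm{id})(\Delta(b)+\tau\Delta(b))=(\mathrm{id}\otimes R_A(b)-R_A(b)\otimes\mathrm{id})(\Delta(a)+\tau\Delta(a)).$$ A Manin triple of Novikov algebras $(A\oplus A^*,(A,\circ),(A^*,\cdot))$ is a Novikov algebra structure (product denoted by juxtaposition) on the vector space $A\oplus A^*$ containing $(A,\circ)$ and $(A^*,\cdot)$ as subalgebras and such that the bilinear form $\mathcal{B}(a+f,b+g)=\langle f,b\rangle+\langle g,a\rangle$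 ($a,b\in A$, $f,g\in A^*$) is invariant: $\mathcal{B}(xy,z)=-\mathcal{B}(y,xz+zx)$ for all $x,y,z\in A\oplus A^*$. A representation of a Novikov algebra $(A,\circ)$ is $(V,l_A,r_A)$ with linear $l_A,r_A:A\to\mathrm{End}(V)$ such that $l_A(a\circ b-b\circ a)=l_A(a)l_A(b)-l_A(b)l_A(a)$, $l_A(a)r_A(b)-r_A(b)l_A(a)=r_A(a\circ b)-r_A(b)r_A(a)$, $l_A(a\circ b)=r_A(b)l_A(a)$, $r_A(a)r_A(b)=r_A(b)r_A(a)$. A matched pair of Novikov algebras is $(A,B,l_A,r_A,l_B,r_B)$ where $(A,\circ)$, $(B,\cdot)$ are Novikov algebras, $(B,l_A,r_A)$ is a representation of $A$, $(A,l_B,r_B)$ is a representation of $B$ and for all $a,b\in A$, $x,y\in B$: (1) $l_B(x)(a\circ b)=-l_B(l_A(a)x-r_A(a)x)b+(l_B(x)a-r_B(x)a)\circ b+r_B(r_A(b)x)a+a\circ(l_B(x)b)$; (2) $r_B(x)(a\circ b-b\circ a)=r_B(l_A(b)x)a-r_B(l_A(a)x)b+a\circ(r_B(x)b)-b\circ(r_B(x)a)$; (3) $l_A(a)(x\cdot y)=-l_A(l_B(x)a-r_B(x)a)y+(l_A(a)x-r_A(a)x)\cdot y+r_A(r_B(y)a)x+x\cdot(l_A(a)y)$; (4) $r_A(a)(x\cdot y-y\cdot x)=r_A(l_B(y)a)x-r_A(l_B(x)a)y+x\cdot(r_A(a)y)-y\cdot(r_A(a)x)$; (5) $(l_B(x)a)\circ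 b+l_B(r_A(a)x)b=(l_B(x)b)\circ a+l_B(r_A(b)x)a$; (6) $(r_B(x)a)\circ b+l_B(l_A(a)x)b=r_B(x)(a\circ b)$; (7) $l_A(r_B(x)a)y+(l_A(a)x)\cdot y=l_A(r_B(y)a)x+(l_A(a)y)\cdot x$; (8) $l_A(l_B(x)a)y+(r_A(a)x)\cdot y=r_A(a)(x\cdot y)$. *)

theory Defs
  imports "HOL-Analysis.Product_Vector" "HOL-Library.Function_Algebras"
begin

section \<open>Linear algebra on subspaces\<close>

text \<open>
  The space \<open>A\<close> is a whole type with a scalar multiplication \<open>smul\<close>. Its dual, and hence
  \<open>A \<oplus> A\<^sup>*\<close>, is only a subspace of a type, so the algebraic notions below take a carrier
  and constrain the operations on that carrier only.
\<close>

definition linear_on ::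
  "('k::field \<Rightarrow> 'u::ab_group_add \<Rightarrow> 'u) \<Rightarrow> ('k \<Rightarrow> 'v::ab_group_add \<Rightarrow> 'v) \<Rightarrow>
   'u set \<Rightarrow> 'v set \<Rightarrow> ('u \<Rightarrow> 'v) \<Rightarrow> bool" where
  "linear_on s1 s2 U V f \<longleftrightarrow>
     (\<forall>x\<in>U. f x \<in> V) \<and>
     (\<forall>x\<in>U. \<forall>y\<in>U. f (x + y) = f x + f y) \<and>
     (\<forall>c. \<forall>x\<in>U. f (s1 c x) = s2 c (f x))"

definition bilinear_on ::
  "('k::field \<Rightarrow> 'u::ab_group_add \<Rightarrow> 'u) \<Rightarrow> ('k \<Rightarrow> 'v::ab_group_add \<Rightarrow> 'v) \<Rightarrow>
   ('k \<Rightarrow> 'w::ab_group_add \<Rightarrow> 'w) \<Rightarrow> 'u set \<Rightarrow> 'v set \<Rightarrow> 'w set \<Rightarrow> ('u \<Rightarrow> 'v \<Rightarrow> 'w) \<Rightarrow> bool" where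
  "bilinear_on s1 s2 s3 U V W h \<longleftrightarrow>
     (\<forall>u\<in>U. linear_on s2 s3 V W (h u)) \<and>
     (\<forall>v\<in>V. linear_on s1 s3 U W (\<lambda>u. h u v))"

definition fun_scale :: "('k \<Rightarrow> 'v \<Rightarrow> 'v) \<Rightarrow> 'k \<Rightarrow> ('x \<Rightarrow> 'v) \<Rightarrow> 'x \<Rightarrow> 'v" where
  "fun_scale s c f = (\<lambda>x. s c (f x))"

lemma vector_space_fun_scale: "vector_space s \<Longrightarrow> vector_space (fun_scale s)"
  unfolding vector_space_def fun_scale_def by (auto simp: fun_eq_iff)

lemma vector_space_mult: "vector_space ((*) :: 'k::field \<Rightarrow> 'k \<Rightarrow> 'k)"
  unfolding vector_space_def by (auto simp: algebra_simps)

definition dual :: "('k::field \<Rightarrow> 'a::ab_group_add \<Rightarrow> 'a) \<Rightarrow> ('a \<Rightarrow> 'k) set" where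
  "dual smul = {f. Vector_Spaces.linear smul (*) f}"

abbreviation dual_scale :: "'k::field \<Rightarrow> ('a \<Rightarrow> 'k) \<Rightarrow> 'a \<Rightarrow> 'k" where
  "dual_scale \<equiv> fun_scale (*)"

abbreviation sum_scale ::
  "('k::field \<Rightarrow> 'a::ab_group_add \<Rightarrow> 'a) \<Rightarrow> 'k \<Rightarrow> 'a \<times> ('a \<Rightarrow> 'k) \<Rightarrow> 'a \<times> ('a \<Rightarrow> 'k)" where
  "sum_scale smul \<equiv> module_prod.scale smul dual_scale"


section \<open>Tensor products\<close>

text \<open>
  \<open>A \<otimes> A\<close> is modelled as the span of the bilinear forms \<open>(f, g) \<mapsto> f(a) g(b)\<close> on the dual
  space, so that \<open>\<langle>f \<otimes> g, t\<rangle>\<close> is \<open>t f g\<close>. The forms are extended by \<open>0\<close> outside the dual,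
  since HOL functions are total. The universal property of this model is proved below.
  Elements of \<open>A \<otimes> A \<otimes> A\<close> are in the same way trilinear forms on the dual space; they occur
  only in equations, so the corresponding span is not needed.
\<close>

type_synonym ('k, 'a) tensor2 = "('a \<Rightarrow> 'k) \<Rightarrow> ('a \<Rightarrow> 'k) \<Rightarrow> 'k"
type_synonym ('k, 'a) tensor3 = "('a \<Rightarrow> 'k) \<Rightarrow> ('a \<Rightarrow> 'k) \<Rightarrow> ('a \<Rightarrow> 'k) \<Rightarrow> 'k"

abbreviation tensor2_scale :: "'k::field \<Rightarrow> ('k, 'a) tensor2 \<Rightarrow> ('k, 'a) tensor2" where
  "tensor2_scale \<equiv> fun_scale (fun_scale (*))"

definition pure2 ::
  "('k::field \<Rightarrow> 'a::ab_group_add \<Rightarrow> 'a) \<Rightarrow> 'a \<Rightarrow> 'a \<Rightarrow> ('k, 'a) tensor2" where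
  "pure2 smul a b = (\<lambda>f g. if f \<in> dual smul \<and> g \<in> dual smul then f a * g b else 0)"

definition pure3 ::
  "('k::field \<Rightarrow> 'a::ab_group_add \<Rightarrow> 'a) \<Rightarrow> 'a \<Rightarrow> 'a \<Rightarrow> 'a \<Rightarrow> ('k, 'a) tensor3" where
  "pure3 smul a b c = (\<lambda>f g h.
     if f \<in> dual smul \<and> g \<in> dual smul \<and> h \<in> dual smul then f a * g b * h c else 0)"

definition tensor2_space ::
  "('k::field \<Rightarrow> 'a::ab_group_add \<Rightarrow> 'a) \<Rightarrow> ('k, 'a) tensor2 set" where
  "tensor2_space smul = module.span tensor2_scale {pure2 smul a b |a b. True}"

text \<open>The maps \<open>\<phi> \<otimes> \<psi>\<close>, \<open>\<tau>\<close>, \<open>id \<otimes> \<Delta>\<close>, \<open>\<Delta> \<otimes> id\<close> and \<open>\<tau> \<otimes> id\<close>,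
  written as transposes; see the lemmas below for their values on pure tensors.\<close>

definition tensor_map ::
  "('k::field \<Rightarrow> 'a::ab_group_add \<Rightarrow> 'a) \<Rightarrow> ('a \<Rightarrow> 'a) \<Rightarrow> ('a \<Rightarrow> 'a) \<Rightarrow>
   ('k, 'a) tensor2 \<Rightarrow> ('k, 'a) tensor2" where
  "tensor_map smul \<phi> \<psi> t =
     (\<lambda>f g. if f \<in> dual smul \<and> g \<in> dual smul then t (f \<circ> \<phi>) (g \<circ> \<psi>) else 0)"

definition swap :: "('k, 'a) tensor2 \<Rightarrow> ('k, 'a) tensor2" where
  "swap t = (\<lambda>f g. t g f)"

definition id_tensor :: "('a \<Rightarrow> ('k, 'a) tensor2) \<Rightarrow> ('k, 'a) tensor2 \<Rightarrow> ('k, 'a) tensor3" where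
  "id_tensor \<Delta> t = (\<lambda>f g h. t f (\<lambda>b. \<Delta> b g h))"

definition tensor_id :: "('a \<Rightarrow> ('k, 'a) tensor2) \<Rightarrow> ('k, 'a) tensor2 \<Rightarrow> ('k, 'a) tensor3" where
  "tensor_id \<Delta> t = (\<lambda>f g h. t (\<lambda>a. \<Delta> a f g) h)"

definition swap_id :: "('k, 'a) tensor3 \<Rightarrow> ('k, 'a) tensor3" where
  "swap_id t = (\<lambda>f g h. t g f h)"

lemma tensor_map_pure:
  assumes "Vector_Spaces.linear smul smul \<phi>" "Vector_Spaces.linear smul smul \<psi>"
  shows "tensor_map smul \<phi> \<psi> (pure2 smul a b) = pure2 smul (\<phi> a) (\<psi> b)"
proof -
  have "f \<circ> \<phi> \<in> dual smul" "f \<circ> \<psi> \<in> dual smul" if "f \<in> dual smul" for f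
    using that assms by (auto simp: dual_def intro: Vector_Spaces.linear_compose)
  then show ?thesis
    by (auto simp: tensor_map_def pure2_def fun_eq_iff)
qed

lemma swap_pure: "swap (pure2 smul a b) = pure2 smul b a"
  by (auto simp: swap_def pure2_def fun_eq_iff)

lemma swap_id_pure: "swap_id (pure3 smul a b c) = pure3 smul b a c"
  by (auto simp: swap_id_def pure3_def fun_eq_iff)

lemma tensor2_outside_dual:
  assumes "t \<in> tensor2_space smul" "f \<notin> dual smul \<or> g \<notin> dual smul"
  shows "t f g = 0"
proof -
  interpret T: vector_space tensor2_scale
    by (intro vector_space_fun_scale vector_space_mult)
  show ?thesis
    using assms(1) unfolding tensor2_space_def
  proof (induction rule: T.span_induct_alt)
    case base
    show ?case by simp
  next
    case (step c x y)
    then show ?case using assms(2) by (auto simp: pure2_def fun_scale_def)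
  qed
qed

lemma coproduct_functional:
  assumes "Vector_Spaces.linear smul tensor2_scale \<Delta>"
  shows "(\<lambda>a. \<Delta> a f g) \<in> dual smul"
proof -
  interpret \<Delta>: Vector_Spaces.linear smul tensor2_scale \<Delta> by fact
  show ?thesis unfolding dual_def mem_Collect_eq
    by unfold_locales (auto simp: \<Delta>.add \<Delta>.scale fun_scale_def algebra_simps)
qed

lemma id_tensor_pure:
  assumes \<Delta>: "Vector_Spaces.linear smul tensor2_scale \<Delta>" "range \<Delta> \<subseteq> tensor2_space smul"
  shows "id_tensor \<Delta> (pure2 smul a b) = (\<lambda>f g h. if f \<in> dual smul then f a * \<Delta> b g h else 0)"
  using coproduct_functional[OF \<Delta>(1)] by (auto simp: id_tensor_def pure2_def fun_eq_iff)

lemma tensor_id_pure: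
  assumes \<Delta>: "Vector_Spaces.linear smul tensor2_scale \<Delta>" "range \<Delta> \<subseteq> tensor2_space smul"
  shows "tensor_id \<Delta> (pure2 smul a b) = (\<lambda>f g h. if h \<in> dual smul then \<Delta> a f g * h b else 0)"
  using coproduct_functional[OF \<Delta>(1)] by (auto simp: tensor_id_def pure2_def fun_eq_iff)

lemma pure3_conv_pure2:
  "(\<lambda>f g h. if f \<in> dual smul then f a * pure2 smul b c g h else 0) = pure3 smul a b c"
  "(\<lambda>f g h. if h \<in> dual smul then pure2 smul a b f g * h c else 0) = pure3 smul a b c"
  by (auto simp: pure2_def pure3_def fun_eq_iff)

lemma bilinear_pure2:
  assumes "vector_space smul"
  shows "bilinear_on smul smul tensor2_scale UNIV UNIV (tensor2_space smul) (pure2 smul)"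
proof -
  interpret T: vector_space tensor2_scale
    by (intro vector_space_fun_scale vector_space_mult)
  have mem: "pure2 smul a b \<in> tensor2_space smul" for a b
    unfolding tensor2_space_def by (rule T.span_base) auto
  have *: "f (x + y) = f x + f y" "f (smul c x) = c * f x" if "f \<in> dual smul" for f x y c
    using that
    by (auto simp: dual_def Vector_Spaces.linear_def module_hom.add module_hom.scale)
  show ?thesis
    unfolding bilinear_on_def linear_on_def
    by (auto simp: mem) (auto simp: pure2_def fun_scale_def fun_eq_iff * algebra_simps)
qed

context finite_dimensional_vector_space
begin

lemma coordinate_in_dual: "(\<lambda>x. representation Basis x b) \<in> dual scale"
  unfolding dual_def mem_Collect_eq
  by unfold_locales
    (auto simp: representation_add representation_scale independent_Basis span_Basis algebra_simps)

lemma coordinate_expansion: "(\<Sum>b\<in>Basis. scale (representation Basis x b) b) = x"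
  using independent_Basis finite_Basis span_Basis by (intro sum_representation_eq) auto

theorem tensor2_universal_property:
  assumes h: "bilinear_on scale scale s UNIV UNIV W h"
    and W: "vector_space s" "module.subspace s W"
  shows "\<exists>F. linear_on tensor2_scale s (tensor2_space scale) W F \<and>
             (\<forall>a b. F (pure2 scale a b) = h a b)"
    and "\<lbrakk>linear_on tensor2_scale s (tensor2_space scale) W F;
          linear_on tensor2_scale s (tensor2_space scale) W G;
          \<forall>a b. F (pure2 scale a b) = G (pure2 scale a b); t \<in> tensor2_space scale\<rbrakk>
         \<Longrightarrow> F t = G t"
proof -
  interpret W: vector_space s by fact
  interpret T: vector_space tensor2_scale
    by (intro vector_space_fun_scale vector_space_mult)
  define e where "e b = (\<lambda>x. representation Basis x b)" for b
  define F where "F t = (\<Sum>b\<in>Basis. \<Sum>c\<in>Basis. s (t (e b) (e c)) (h b c))" for t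
  have hW: "h a b \<in> W" for a b
    using h by (auto simp: bilinear_on_def linear_on_def)
  interpret h1: Vector_Spaces.linear scale s "\<lambda>u. h u v" for v
    using h by unfold_locales (auto simp: bilinear_on_def linear_on_def algebra_simps)
  interpret h2: Vector_Spaces.linear scale s "h u" for u
    using h by unfold_locales (auto simp: bilinear_on_def linear_on_def algebra_simps)
  have "F (pure2 scale x y) = h x y" for x y
  proof -
    have "h x y = h (\<Sum>b\<in>Basis. scale (e b x) b) (\<Sum>c\<in>Basis. scale (e c y) c)"
      by (simp add: e_def coordinate_expansion)
    also have "\<dots> = F (pure2 scale x y)"
      unfolding F_def
      by (simp add: h1.sum h2.sum h1.scale h2.scale pure2_def e_def coordinate_in_dual
          W.scale_sum_right)
        (subst sum.swap, simp add: mult.commute)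
    finally show ?thesis ..
  qed
  moreover have "linear_on tensor2_scale s (tensor2_space scale) W F"
    unfolding linear_on_def F_def
    by (auto simp: fun_scale_def W.scale_left_distrib sum.distrib W.scale_sum_right hW W(2)
        intro!: W.subspace_sum W.subspace_scale)
  ultimately show "\<exists>F. linear_on tensor2_scale s (tensor2_space scale) W F \<and>
      (\<forall>a b. F (pure2 scale a b) = h a b)"
    by blast
next
  interpret W: vector_space s by fact
  interpret T: vector_space tensor2_scale
    by (intro vector_space_fun_scale vector_space_mult)
  assume F: "linear_on tensor2_scale s (tensor2_space scale) W F"
    and G: "linear_on tensor2_scale s (tensor2_space scale) W G"
    and eq: "\<forall>a b. F (pure2 scale a b) = G (pure2 scale a b)"
    and t: "t \<in> tensor2_space scale"
  have zero: "H 0 = 0" if "linear_on tensor2_scale s (tensor2_space scale) W H" for H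
  proof -
    have "0 \<in> tensor2_space scale" unfolding tensor2_space_def by (rule T.span_zero)
    then have "H (tensor2_scale 0 0) = s 0 (H 0)" using that unfolding linear_on_def by blast
    then show ?thesis by simp
  qed
  have "t \<in> tensor2_space scale \<and> F t = G t"
    using t unfolding tensor2_space_def
  proof (induction rule: T.span_induct_alt)
    case base
    show ?case
    proof
      show "F 0 = G 0" using zero[OF F] zero[OF G] by metis
    qed (rule T.span_zero)
  next
    case (step c x y)
    have x: "x \<in> tensor2_space scale" and cx: "tensor2_scale c x \<in> tensor2_space scale"
      using step(1) unfolding tensor2_space_def by (auto intro: T.span_base T.span_scale)
    have y: "y \<in> tensor2_space scale" using step unfolding tensor2_space_def by simp
    have lin: "H (tensor2_scale c x + y) = s c (H x) + H y"
      if "linear_on tensor2_scale s (tensor2_space scale) W H" for H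
    proof -
      have "H (tensor2_scale c x + y) = H (tensor2_scale c x) + H y"
        using that cx y unfolding linear_on_def by blast
      moreover have "H (tensor2_scale c x) = s c (H x)"
        using that x unfolding linear_on_def by blast
      ultimately show ?thesis by (simp only:)
    qed
    have "F x = G x" using step(1) eq by auto
    moreover have "tensor2_scale c x + y \<in> tensor2_space scale"
      using cx y unfolding tensor2_space_def by (rule T.span_add)
    ultimately have "F (tensor2_scale c x + y) = G (tensor2_scale c x + y)"
      using lin[OF F] lin[OF G] step(2) by (simp only:)
    then show ?case
      using \<open>tensor2_scale c x + y \<in> tensor2_space scale\<close> unfolding tensor2_space_def by blast
  qed
  then show "F t = G t" ..
qed

end


section \<open>Novikov algebras, coalgebras and bialgebras\<close>

definition novikov_algebra ::
  "('k::field \<Rightarrow> 'v::ab_group_add \<Rightarrow> 'v) \<Rightarrow> 'v set \<Rightarrow> ('v \<Rightarrow> 'v \<Rightarrow> 'v) \<Rightarrow> bool" where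
  "novikov_algebra s V m \<longleftrightarrow>
     vector_space s \<and> module.subspace s V \<and> bilinear_on s s s V V V m \<and>
     (\<forall>a\<in>V. \<forall>b\<in>V. \<forall>c\<in>V. m (m a b) c - m a (m b c) = m (m b a) c - m b (m a c)) \<and>
     (\<forall>a\<in>V. \<forall>b\<in>V. \<forall>c\<in>V. m (m a b) c = m (m a c) b)"

definition novikov_coalgebra ::
  "('k::field \<Rightarrow> 'a::ab_group_add \<Rightarrow> 'a) \<Rightarrow> ('a \<Rightarrow> ('k, 'a) tensor2) \<Rightarrow> bool" where
  "novikov_coalgebra smul \<Delta> \<longleftrightarrow>
     Vector_Spaces.linear smul tensor2_scale \<Delta> \<and> range \<Delta> \<subseteq> tensor2_space smul \<and>
     (\<forall>a. id_tensor \<Delta> (\<Delta> a) - swap_id (id_tensor \<Delta> (\<Delta> a)) =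
          tensor_id \<Delta> (\<Delta> a) - swap_id (tensor_id \<Delta> (\<Delta> a))) \<and>
     (\<forall>a. swap_id (id_tensor \<Delta> (swap (\<Delta> a))) = tensor_id \<Delta> (\<Delta> a))"

definition R_mult :: "('v \<Rightarrow> 'v \<Rightarrow> 'v) \<Rightarrow> 'v \<Rightarrow> 'v \<Rightarrow> 'v" where
  "R_mult m a b = m b a"

definition L_star :: "('v \<Rightarrow> 'v \<Rightarrow> 'v::plus) \<Rightarrow> 'v \<Rightarrow> 'v \<Rightarrow> 'v" where
  "L_star m a b = m a b + m b a"

definition novikov_bialgebra ::
  "('k::field \<Rightarrow> 'a::ab_group_add \<Rightarrow> 'a) \<Rightarrow> ('a \<Rightarrow> 'a \<Rightarrow> 'a) \<Rightarrow> ('a \<Rightarrow> ('k, 'a) tensor2) \<Rightarrow> bool" where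
  "novikov_bialgebra smul m \<Delta> \<longleftrightarrow>
     novikov_algebra smul UNIV m \<and> novikov_coalgebra smul \<Delta> \<and>
     (\<forall>a b. \<Delta> (m a b) =
        tensor_map smul (R_mult m b) id (\<Delta> a) +
        tensor_map smul id (L_star m a) (\<Delta> b + swap (\<Delta> b))) \<and>
     (\<forall>a b.
        tensor_map smul (L_star m a) id (\<Delta> b) - tensor_map smul id (L_star m a) (swap (\<Delta> b)) =
        tensor_map smul (L_star m b) id (\<Delta> a) - tensor_map smul id (L_star m b) (swap (\<Delta> a))) \<and>
     (\<forall>a b.
        tensor_map smul id (R_mult m a) (\<Delta> b + swap (\<Delta> b)) -
        tensor_map smul (R_mult m a) id (\<Delta> b + swap (\<Delta> b)) =
        tensor_map smul id (R_mult m b) (\<Delta> a + swap (\<Delta> a)) -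
        tensor_map smul (R_mult m b) id (\<Delta> a + swap (\<Delta> a)))"

definition dual_mult :: "('a \<Rightarrow> ('k, 'a) tensor2) \<Rightarrow> ('a \<Rightarrow> 'k) \<Rightarrow> ('a \<Rightarrow> 'k) \<Rightarrow> 'a \<Rightarrow> 'k" where
  "dual_mult \<Delta> f g = (\<lambda>a. \<Delta> a f g)"


section \<open>Matched pairs and Manin triples\<close>

definition novikov_representation ::
  "('k::field \<Rightarrow> 'a::ab_group_add \<Rightarrow> 'a) \<Rightarrow> 'a set \<Rightarrow> ('a \<Rightarrow> 'a \<Rightarrow> 'a) \<Rightarrow>
   ('k \<Rightarrow> 'v::ab_group_add \<Rightarrow> 'v) \<Rightarrow> 'v set \<Rightarrow> ('a \<Rightarrow> 'v \<Rightarrow> 'v) \<Rightarrow> ('a \<Rightarrow> 'v \<Rightarrow> 'v) \<Rightarrow> bool" where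
  "novikov_representation sA A m sV V l r \<longleftrightarrow>
     vector_space sV \<and> module.subspace sV V \<and>
     bilinear_on sA sV sV A V V l \<and> bilinear_on sA sV sV A V V r \<and>
     (\<forall>a\<in>A. \<forall>b\<in>A. \<forall>v\<in>V.
        l (m a b - m b a) v = l a (l b v) - l b (l a v) \<and>
        l a (r b v) - r b (l a v) = r (m a b) v - r b (r a v) \<and>
        l (m a b) v = r b (l a v) \<and>
        r a (r b v) = r b (r a v))"

definition matched_pair ::
  "('k::field \<Rightarrow> 'a::ab_group_add \<Rightarrow> 'a) \<Rightarrow> 'a set \<Rightarrow> ('a \<Rightarrow> 'a \<Rightarrow> 'a) \<Rightarrow>
   ('k \<Rightarrow> 'b::ab_group_add \<Rightarrow> 'b) \<Rightarrow> 'b set \<Rightarrow> ('b \<Rightarrow> 'b \<Rightarrow> 'b) \<Rightarrow>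
   ('a \<Rightarrow> 'b \<Rightarrow> 'b) \<Rightarrow> ('a \<Rightarrow> 'b \<Rightarrow> 'b) \<Rightarrow> ('b \<Rightarrow> 'a \<Rightarrow> 'a) \<Rightarrow> ('b \<Rightarrow> 'a \<Rightarrow> 'a) \<Rightarrow> bool" where
  "matched_pair sA A mA sB B mB lA rA lB rB \<longleftrightarrow>
     novikov_algebra sA A mA \<and> novikov_algebra sB B mB \<and>
     novikov_representation sA A mA sB B lA rA \<and>
     novikov_representation sB B mB sA A lB rB \<and>
     (\<forall>a\<in>A. \<forall>b\<in>A. \<forall>x\<in>B.
        lB x (mA a b) =
          - lB (lA a x - rA a x) b + mA (lB x a - rB x a) b + rB (rA b x) a + mA a (lB x b)) \<and>
     (\<forall>a\<in>A. \<forall>b\<in>A. \<forall>x\<in>B.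
        rB x (mA a b - mA b a) =
          rB (lA b x) a - rB (lA a x) b + mA a (rB x b) - mA b (rB x a)) \<and>
     (\<forall>a\<in>A. \<forall>x\<in>B. \<forall>y\<in>B.
        lA a (mB x y) =
          - lA (lB x a - rB x a) y + mB (lA a x - rA a x) y + rA (rB y a) x + mB x (lA a y)) \<and>
     (\<forall>a\<in>A. \<forall>x\<in>B. \<forall>y\<in>B.
        rA a (mB x y - mB y x) =
          rA (lB y a) x - rA (lB x a) y + mB x (rA a y) - mB y (rA a x)) \<and>
     (\<forall>a\<in>A. \<forall>b\<in>A. \<forall>x\<in>B.
        mA (lB x a) b + lB (rA a x) b = mA (lB x b) a + lB (rA b x) a) \<and>
     (\<forall>a\<in>A. \<forall>b\<in>A. \<forall>x\<in>B.
        mA (rB x a) b + lB (lA a x) b = rB x (mA a b)) \<and>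
     (\<forall>a\<in>A. \<forall>x\<in>B. \<forall>y\<in>B.
        lA (rB x a) y + mB (lA a x) y = lA (rB y a) x + mB (lA a y) x) \<and>
     (\<forall>a\<in>A. \<forall>x\<in>B. \<forall>y\<in>B.
        lA (lB x a) y + mB (rA a x) y = rA a (mB x y))"

definition dual_rep :: "('u \<Rightarrow> 'v \<Rightarrow> 'v) \<Rightarrow> 'u \<Rightarrow> ('v \<Rightarrow> 'k::uminus) \<Rightarrow> 'v \<Rightarrow> 'k" where
  "dual_rep \<phi> a f = (\<lambda>v. - f (\<phi> a v))"

text \<open>
  For \<open>\<phi> : A\<^sup>* \<rightarrow> End(A\<^sup>*)\<close>, the dual representation acts on \<open>(A\<^sup>*)\<^sup>*\<close>. Under \<open>A = (A\<^sup>*)\<^sup>*\<close>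
  the element \<open>a\<close> is the functional \<open>g \<mapsto> g(a)\<close>, and the result is the element of \<open>A\<close> representing
  the image functional.
\<close>
definition bidual_rep ::
  "('k::field \<Rightarrow> 'a::ab_group_add \<Rightarrow> 'a) \<Rightarrow> (('a \<Rightarrow> 'k) \<Rightarrow> ('a \<Rightarrow> 'k) \<Rightarrow> 'a \<Rightarrow> 'k) \<Rightarrow>
   ('a \<Rightarrow> 'k) \<Rightarrow> 'a \<Rightarrow> 'a" where
  "bidual_rep smul \<phi> f a = (THE b. \<forall>g\<in>dual smul. g b = dual_rep \<phi> f (\<lambda>g'. g' a) g)"

context finite_dimensional_vector_space
begin

theorem bidual_rep_unique_existence:
  assumes \<phi>: "linear_on dual_scale dual_scale (dual scale) (dual scale) (\<phi> f)"
  shows "\<exists>!b. \<forall>g\<in>dual scale. g b = dual_rep \<phi> f (\<lambda>g'. g' a) g"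
proof -
  define e where "e b = (\<lambda>x. representation Basis x b)" for b
  have e: "e b \<in> dual scale" for b
    unfolding e_def by (rule coordinate_in_dual)
  have subsp: "0 \<in> dual scale" "\<And>g h. g \<in> dual scale \<Longrightarrow> h \<in> dual scale \<Longrightarrow> g + h \<in> dual scale"
    "\<And>c g. g \<in> dual scale \<Longrightarrow> dual_scale c g \<in> dual scale"
    by (auto simp: dual_def Vector_Spaces.linear_iff fun_scale_def algebra_simps
        vector_space_axioms vector_space_mult)
  have lin: "g (\<Sum>b\<in>Basis. scale (c b) b) = (\<Sum>b\<in>Basis. c b * g b)" if "g \<in> dual scale" for g c
  proof -
    interpret g: Vector_Spaces.linear scale "(*)" g using that by (simp add: dual_def)
    show ?thesis by (simp add: g.sum g.scale)
  qed
  have expand: "g = (\<Sum>b\<in>Basis. dual_scale (g b) (e b))" if "g \<in> dual scale" for g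
  proof
    fix x
    have "g x = (\<Sum>b\<in>Basis. e b x * g b)"
      using lin[OF that, of "\<lambda>b. e b x"] by (simp add: e_def coordinate_expansion)
    moreover have "(\<Sum>b\<in>S. dual_scale (g b) (e b)) x = (\<Sum>b\<in>S. e b x * g b)" if "finite S" for S
      using that by (induction S) (auto simp: fun_scale_def mult.commute)
    ultimately show "g x = (\<Sum>b\<in>Basis. dual_scale (g b) (e b)) x"
      using finite_Basis by simp
  qed
  have phi0: "\<phi> f 0 = 0"
  proof -
    have "\<phi> f (dual_scale 0 0) = dual_scale 0 (\<phi> f 0)"
      using \<phi> subsp(1) unfolding linear_on_def by blast
    then show ?thesis by (simp add: fun_scale_def fun_eq_iff zero_fun_def)
  qed
  have "(\<Sum>b\<in>S. dual_scale (c b) (e b)) \<in> dual scale \<and>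
      \<phi> f (\<Sum>b\<in>S. dual_scale (c b) (e b)) a = (\<Sum>b\<in>S. c b * \<phi> f (e b) a)"
    if "finite S" for S c
    using that
  proof (induction S)
    case empty
    show ?case using subsp(1) phi0 by (simp add: zero_fun_def)
  next
    case (insert b S)
    define u where "u = (\<Sum>b\<in>S. dual_scale (c b) (e b))"
    have u: "u \<in> dual scale" "\<phi> f u a = (\<Sum>b\<in>S. c b * \<phi> f (e b) a)"
      using insert.IH by (auto simp: u_def)
    have v: "dual_scale (c b) (e b) \<in> dual scale"
      using e subsp(3) by blast
    have "\<phi> f (dual_scale (c b) (e b) + u) = dual_scale (c b) (\<phi> f (e b)) + \<phi> f u"
      using \<phi> e[of b] u(1) v unfolding linear_on_def by metis
    then have "\<phi> f (dual_scale (c b) (e b) + u) a = c b * \<phi> f (e b) a + \<phi> f u a"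
      by (simp add: fun_scale_def)
    moreover have "(\<Sum>b\<in>insert b S. dual_scale (c b) (e b)) = dual_scale (c b) (e b) + u"
      using insert.hyps by (simp add: u_def)
    ultimately show ?case
      using u subsp(2)[OF v u(1)] insert.hyps by (simp only: sum.insert not_False_eq_True simp_thms)
  qed
  then have sum: "\<phi> f g a = (\<Sum>b\<in>Basis. g b * \<phi> f (e b) a)" if "g \<in> dual scale" for g
    using expand[OF that] finite_Basis by metis
  show ?thesis
  proof (rule ex1I)
    show "\<forall>g\<in>dual scale.
        g (\<Sum>b\<in>Basis. scale (- \<phi> f (e b) a) b) = dual_rep \<phi> f (\<lambda>g'. g' a) g"
    proof
      fix g
      assume g: "g \<in> dual scale"
      show "g (\<Sum>b\<in>Basis. scale (- \<phi> f (e b) a) b) = dual_rep \<phi> f (\<lambda>g'. g' a) g"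
        unfolding lin[OF g] dual_rep_def sum[OF g] by (simp add: sum_negf mult.commute)
    qed
  next
    fix x
    assume "\<forall>g\<in>dual scale. g x = dual_rep \<phi> f (\<lambda>g'. g' a) g"
    then have "e b x = - \<phi> f (e b) a" for b
      using e[of b] by (simp add: dual_rep_def)
    then show "x = (\<Sum>b\<in>Basis. scale (- \<phi> f (e b) a) b)"
      using coordinate_expansion[of x] by (simp add: e_def)
  qed
qed

end

definition manin_form :: "'a \<times> ('a \<Rightarrow> 'k::plus) \<Rightarrow> 'a \<times> ('a \<Rightarrow> 'k) \<Rightarrow> 'k" where
  "manin_form u v = snd u (fst v) + snd v (fst u)"

definition manin_triple ::
  "('k::field \<Rightarrow> 'a::ab_group_add \<Rightarrow> 'a) \<Rightarrow> ('a \<Rightarrow> 'a \<Rightarrow> 'a) \<Rightarrow>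
   (('a \<Rightarrow> 'k) \<Rightarrow> ('a \<Rightarrow> 'k) \<Rightarrow> 'a \<Rightarrow> 'k) \<Rightarrow>
   ('a \<times> ('a \<Rightarrow> 'k) \<Rightarrow> 'a \<times> ('a \<Rightarrow> 'k) \<Rightarrow> 'a \<times> ('a \<Rightarrow> 'k)) \<Rightarrow> bool" where
  "manin_triple smul mA mD M \<longleftrightarrow>
     novikov_algebra (sum_scale smul) (UNIV \<times> dual smul) M \<and>
     (\<forall>a b. M (a, 0) (b, 0) = (mA a b, 0)) \<and>
     (\<forall>f\<in>dual smul. \<forall>g\<in>dual smul. M (0, f) (0, g) = (0, mD f g)) \<and>
     (\<forall>x\<in>UNIV \<times> dual smul. \<forall>y\<in>UNIV \<times> dual smul. \<forall>z\<in>UNIV \<times> dual smul.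
        manin_form (M x y) z = - manin_form y (M x z + M z x))"

end

theory Submission
  imports Defs
begin

text \<open>
  Put \<open>a f = (r\<^sub>D(f) a, l\<^sub>A(a) f)\<close> and \<open>f a = (l\<^sub>D(f) a, r\<^sub>A(a) f)\<close>, where
  \<open>l\<^sub>A = L\<^sub>\<star>\<^sup>*\<close>, \<open>r\<^sub>A = -R\<^sup>*\<close> and \<open>l\<^sub>D\<close>, \<open>r\<^sub>D\<close> are the same maps for the algebra \<open>A\<^sup>*\<close>.
  Together with the two given products this defines a product on \<open>A \<oplus> A\<^sup>*\<close>.

  Manin triples and matched pairs. Invariance, \<open>B(xy,z) = -B(y,xz+zx)\<close>, implies
  \<open>B(yx,z) = B(y,zx)\<close>. These two rules determine the mixed products \<open>af\<close> and \<open>fa\<close> from the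
  products on \<open>A\<close> and \<open>A\<^sup>*\<close>, and what they give is the product above, which is invariant
  (\<open>invariant_unique\<close>, \<open>invariant_double_product\<close>). So a Manin triple exists iff that product is
  Novikov. Both Novikov identities are additive in each argument, so it suffices to test them
  on triples from the two summands. The triples inside one summand are covered by the given
  algebras, and the two components of a mixed triple are exactly one representation axiom and
  one of the eight matched pair conditions (\<open>matched_pair_iff_novikov_bowtie\<close>).

  Matched pairs and bialgebras. The dual actions are always representations. The eight
  conditions are tested by pairing with one more element, which turns them into equations between the
  scalars \<open>\<langle>ab, fg\<rangle>\<close> and \<open>\<langle>X(f)a, Y(b)g\<rangle>\<close> with \<open>X\<close> one of \<open>l\<^sub>D, r\<^sub>D\<close> and \<open>Y\<close> one of
  \<open>l\<^sub>A, r\<^sub>A\<close>. In these terms the mixed right commutativity conditions are the three bialgebra axioms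
  (one axiom arises twice, with the roles of \<open>A\<close> and \<open>A\<^sup>*\<close> exchanged), and the
  left symmetry conditions are linear combinations of them (\<open>matched_pair_iff_compatible\<close>).
  As \<open>A\<close> and \<open>A\<^sup>*\<close> enter symmetrically, half of this is obtained by exchanging them.

  Elements of \<open>A \<otimes> A\<close> are bilinear forms on \<open>A\<^sup>*\<close>, so evaluating a coalgebra or bialgebra axiom at
  functionals already gives an identity for the product \<open>\<langle>f \<cdot> g, a\<rangle> = \<Delta>(a)(f, g)\<close>; finite
  dimension enters through \<open>A = (A\<^sup>*)\<^sup>*\<close>, which provides the actions of \<open>A\<^sup>*\<close> on \<open>A\<close>.
\<close>

section \<open>Additivity on subspaces\<close>

lemma bilinear_on_rules:
  assumes h: "bilinear_on s1 s2 s3 U V W h"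
    and "vector_space s1" "module.subspace s1 U" "vector_space s2" "module.subspace s2 V"
  shows "\<lbrakk>u \<in> U; v \<in> V\<rbrakk> \<Longrightarrow> h u v \<in> W"
    and "\<lbrakk>u \<in> U; u' \<in> U; v \<in> V\<rbrakk> \<Longrightarrow> h (u + u') v = h u v + h u' v"
    and "\<lbrakk>u \<in> U; v \<in> V; v' \<in> V\<rbrakk> \<Longrightarrow> h u (v + v') = h u v + h u v'"
    and "\<lbrakk>u \<in> U; u' \<in> U; v \<in> V\<rbrakk> \<Longrightarrow> h (u - u') v = h u v - h u' v"
    and "\<lbrakk>u \<in> U; v \<in> V; v' \<in> V\<rbrakk> \<Longrightarrow> h u (v - v') = h u v - h u v'"
    and "v \<in> V \<Longrightarrow> h 0 v = 0"
    and "u \<in> U \<Longrightarrow> h u 0 = 0"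
    and "\<lbrakk>u \<in> U; v \<in> V\<rbrakk> \<Longrightarrow> h (- u) v = - h u v"
    and "\<lbrakk>u \<in> U; v \<in> V\<rbrakk> \<Longrightarrow> h u (- v) = - h u v"
    and "\<lbrakk>u \<in> U; v \<in> V\<rbrakk> \<Longrightarrow> h (s1 c u) v = s3 c (h u v)"
    and "\<lbrakk>u \<in> U; v \<in> V\<rbrakk> \<Longrightarrow> h u (s2 c v) = s3 c (h u v)"
proof -
  interpret U: vector_space s1 by fact
  interpret V: vector_space s2 by fact
  note U = U.subspace_0[OF assms(3)] U.subspace_diff[OF assms(3)] U.subspace_neg[OF assms(3)]
  note V = V.subspace_0[OF assms(5)] V.subspace_diff[OF assms(5)] V.subspace_neg[OF assms(5)]
  show closed: "u \<in> U \<Longrightarrow> v \<in> V \<Longrightarrow> h u v \<in> W" for u v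
    using h by (auto simp: bilinear_on_def linear_on_def)
  show "\<lbrakk>u \<in> U; v \<in> V\<rbrakk> \<Longrightarrow> h (s1 c u) v = s3 c (h u v)"
    and "\<lbrakk>u \<in> U; v \<in> V\<rbrakk> \<Longrightarrow> h u (s2 c v) = s3 c (h u v)"
    using h by (auto simp: bilinear_on_def linear_on_def)
  show l: "\<lbrakk>u \<in> U; u' \<in> U; v \<in> V\<rbrakk> \<Longrightarrow> h (u + u') v = h u v + h u' v" for u u' v
    using h by (auto simp: bilinear_on_def linear_on_def)
  show r: "\<lbrakk>u \<in> U; v \<in> V; v' \<in> V\<rbrakk> \<Longrightarrow> h u (v + v') = h u v + h u v'" for u v v'
    using h by (auto simp: bilinear_on_def linear_on_def)
  show dl: "\<lbrakk>u \<in> U; u' \<in> U; v \<in> V\<rbrakk> \<Longrightarrow> h (u - u') v = h u v - h u' v" for u u' v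
    using l[of "u - u'" u' v] U(2)[of u u'] by (simp add: algebra_simps)
  show dr: "\<lbrakk>u \<in> U; v \<in> V; v' \<in> V\<rbrakk> \<Longrightarrow> h u (v - v') = h u v - h u v'" for u v v'
    using r[of u "v - v'" v'] V(2)[of v v'] by (simp add: algebra_simps)
  show zl: "v \<in> V \<Longrightarrow> h 0 v = 0" for v
    using dl[of 0 0 v] U(1) by simp
  show zr: "u \<in> U \<Longrightarrow> h u 0 = 0" for u
    using dr[of u 0 0] V(1) by simp
  show "\<lbrakk>u \<in> U; v \<in> V\<rbrakk> \<Longrightarrow> h (- u) v = - h u v"
    using dl[of 0 u v] zl U by simp
  show "\<lbrakk>u \<in> U; v \<in> V\<rbrakk> \<Longrightarrow> h u (- v) = - h u v"
    using dr[of u 0 v] zr V by simp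
qed

text \<open>
  Used with \<open>H\<close> the union of the two summands of a direct sum \<open>W\<close>; \<open>H\<close> itself need not be a subspace.
\<close>
lemma triadditive_vanishes:
  fixes T :: "'w::ab_group_add \<Rightarrow> 'w \<Rightarrow> 'w \<Rightarrow> 'z::ab_group_add"
  assumes add: "\<And>x x' y z. \<lbrakk>x \<in> W; x' \<in> W; y \<in> W; z \<in> W\<rbrakk> \<Longrightarrow> T (x + x') y z = T x y z + T x' y z"
    "\<And>x y y' z. \<lbrakk>x \<in> W; y \<in> W; y' \<in> W; z \<in> W\<rbrakk> \<Longrightarrow> T x (y + y') z = T x y z + T x y' z"
    "\<And>x y z z'. \<lbrakk>x \<in> W; y \<in> W; z \<in> W; z' \<in> W\<rbrakk> \<Longrightarrow> T x y (z + z') = T x y z + T x y z'"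
    and H: "H \<subseteq> W" "\<And>w. w \<in> W \<Longrightarrow> \<exists>p\<in>H. \<exists>q\<in>H. w = p + q"
    and zero: "\<And>x y z. \<lbrakk>x \<in> H; y \<in> H; z \<in> H\<rbrakk> \<Longrightarrow> T x y z = 0"
    and "x \<in> W" "y \<in> W" "z \<in> W"
  shows "T x y z = 0"
proof -
  have 1: "T x y z = 0" if "x \<in> H" "y \<in> H" "z \<in> W" for x y z
    using H(2)[OF that(3)] that H(1) zero add(3) by (force simp: subset_iff)
  have 2: "T x y z = 0" if "x \<in> H" "y \<in> W" "z \<in> W" for x y z
    using H(2)[OF that(2)] that H(1) 1 add(2) by (force simp: subset_iff)
  show ?thesis
    using H(2)[OF \<open>x \<in> W\<close>] assms(7-9) H(1) 2 add(1) by (force simp: subset_iff)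
qed

section \<open>Matched pairs are Novikov structures on the direct sum\<close>

definition left_symmetric_at :: "('v \<Rightarrow> 'v \<Rightarrow> 'v::ab_group_add) \<Rightarrow> 'v \<Rightarrow> 'v \<Rightarrow> 'v \<Rightarrow> bool" where
  "left_symmetric_at M x y z \<longleftrightarrow> M (M x y) z - M x (M y z) = M (M y x) z - M y (M x z)"

definition right_commutative_at :: "('v \<Rightarrow> 'v \<Rightarrow> 'v) \<Rightarrow> 'v \<Rightarrow> 'v \<Rightarrow> 'v \<Rightarrow> bool" where
  "right_commutative_at M x y z \<longleftrightarrow> M (M x y) z = M (M x z) y"

lemma left_symmetric_at_sym: "left_symmetric_at M x y z \<longleftrightarrow> left_symmetric_at M y x z"
  by (auto simp: left_symmetric_at_def)

lemma right_commutative_at_sym: "right_commutative_at M x y z \<longleftrightarrow> right_commutative_at M x z y"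
  by (auto simp: right_commutative_at_def)

text \<open>
  The product that two Novikov algebras acting on each other put on their direct sum: \<open>l\<close> gives the
  products with the acting element on the left and \<open>r\<close> those with it on the right.
\<close>
definition bowtie ::
  "('a::ab_group_add \<Rightarrow> 'a \<Rightarrow> 'a) \<Rightarrow> ('b::ab_group_add \<Rightarrow> 'b \<Rightarrow> 'b) \<Rightarrow>
   ('a \<Rightarrow> 'b \<Rightarrow> 'b) \<Rightarrow> ('a \<Rightarrow> 'b \<Rightarrow> 'b) \<Rightarrow> ('b \<Rightarrow> 'a \<Rightarrow> 'a) \<Rightarrow> ('b \<Rightarrow> 'a \<Rightarrow> 'a) \<Rightarrow>
   'a \<times> 'b \<Rightarrow> 'a \<times> 'b \<Rightarrow> 'a \<times> 'b" where
  "bowtie mA mB lA rA lB rB x y =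
     (mA (fst x) (fst y) + lB (snd x) (fst y) + rB (snd y) (fst x),
      mB (snd x) (snd y) + lA (fst x) (snd y) + rA (fst y) (snd x))"

lemma bowtie_swap:
  "bowtie mB mA lB rB lA rA (prod.swap x) (prod.swap y) =
   prod.swap (bowtie mA mB lA rA lB rB x y)"
  by (simp add: bowtie_def)

text \<open>
  Exchanging the two summands carries the product to one of the same shape, so that every fact on
  triples with two entries in the first summand yields one on triples with two in the second.
\<close>
lemma bowtie_identities_swap:
  "left_symmetric_at (bowtie mB mA lB rB lA rA) (prod.swap x) (prod.swap y) (prod.swap z) \<longleftrightarrow>
   left_symmetric_at (bowtie mA mB lA rA lB rB) x y z"
  "right_commutative_at (bowtie mB mA lB rB lA rA) (prod.swap x) (prod.swap y) (prod.swap z) \<longleftrightarrow>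
   right_commutative_at (bowtie mA mB lA rA lB rB) x y z"
  unfolding left_symmetric_at_def right_commutative_at_def bowtie_swap
  by (auto simp: prod_eq_iff)

lemma novikov_algebra_altdef:
  "novikov_algebra s V M \<longleftrightarrow>
     vector_space s \<and> module.subspace s V \<and> bilinear_on s s s V V V M \<and>
     (\<forall>x\<in>V. \<forall>y\<in>V. \<forall>z\<in>V. left_symmetric_at M x y z) \<and>
     (\<forall>x\<in>V. \<forall>y\<in>V. \<forall>z\<in>V. right_commutative_at M x y z)"
  unfolding novikov_algebra_def left_symmetric_at_def right_commutative_at_def ..

lemma novikov_identities_by_generators:
  assumes "vector_space s" "module.subspace s W" "bilinear_on s s s W W W M"
    and H: "H \<subseteq> W" "\<And>w. w \<in> W \<Longrightarrow> \<exists>p\<in>H. \<exists>q\<in>H. w = p + q"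
    and LS: "\<And>x y z. \<lbrakk>x \<in> H; y \<in> H; z \<in> H\<rbrakk> \<Longrightarrow> left_symmetric_at M x y z"
    and RC: "\<And>x y z. \<lbrakk>x \<in> H; y \<in> H; z \<in> H\<rbrakk> \<Longrightarrow> right_commutative_at M x y z"
  shows "novikov_algebra s W M"
proof -
  interpret W: vector_space s by fact
  note [simp] = W.subspace_add[OF assms(2)] W.subspace_diff[OF assms(2)]
    bilinear_on_rules[OF assms(3,1,2,1,2)]
  define D where "D x y z = M (M x y) z - M x (M y z) - (M (M y x) z - M y (M x z))" for x y z
  define E where "E x y z = M (M x y) z - M (M x z) y" for x y z
  have "D x y z = 0" if "x \<in> W" "y \<in> W" "z \<in> W" for x y z
    using _ _ _ H _ that
    by (rule triadditive_vanishes)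
      (use LS in \<open>auto simp: D_def left_symmetric_at_def\<close>)
  moreover have "E x y z = 0" if "x \<in> W" "y \<in> W" "z \<in> W" for x y z
    using _ _ _ H _ that
    by (rule triadditive_vanishes)
      (use RC in \<open>auto simp: E_def right_commutative_at_def\<close>)
  ultimately show ?thesis
    using assms(1-3)
    unfolding novikov_algebra_altdef left_symmetric_at_def right_commutative_at_def D_def E_def
    by (simp only: right_minus_eq) simp
qed

locale mutual_actions =
  fixes sA :: "'k::field \<Rightarrow> 'a::ab_group_add \<Rightarrow> 'a" and A :: "'a set" and mA :: "'a \<Rightarrow> 'a \<Rightarrow> 'a"
    and sB :: "'k \<Rightarrow> 'b::ab_group_add \<Rightarrow> 'b" and B :: "'b set" and mB :: "'b \<Rightarrow> 'b \<Rightarrow> 'b"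
    and lA rA :: "'a \<Rightarrow> 'b \<Rightarrow> 'b" and lB rB :: "'b \<Rightarrow> 'a \<Rightarrow> 'a"
  assumes novikov_A: "novikov_algebra sA A mA"
    and novikov_B: "novikov_algebra sB B mB"
    and lA: "bilinear_on sA sB sB A B B lA"
    and rA: "bilinear_on sA sB sB A B B rA"
    and lB: "bilinear_on sB sA sA B A A lB"
    and rB: "bilinear_on sB sA sA B A A rB"
begin

lemma flip: "mutual_actions sB B mB sA A mA lB rB lA rA"
  using novikov_A novikov_B lA rA lB rB by unfold_locales

abbreviation bt where "bt \<equiv> bowtie mA mB lA rA lB rB"

lemma spaces:
  "vector_space sA" "module.subspace sA A" "vector_space sB" "module.subspace sB B"
  "bilinear_on sA sA sA A A A mA" "bilinear_on sB sB sB B B B mB"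
  using novikov_A novikov_B by (auto simp: novikov_algebra_def)

sublocale VA: vector_space sA by (fact spaces)
sublocale VB: vector_space sB by (fact spaces)
sublocale VV: vector_space_prod sA sB ..

lemmas closed [simp] =
  VA.subspace_0[OF spaces(2)] VA.subspace_add[OF spaces(2)] VA.subspace_diff[OF spaces(2)]
  VA.subspace_neg[OF spaces(2)] VA.subspace_scale[OF spaces(2)]
  VB.subspace_0[OF spaces(4)] VB.subspace_add[OF spaces(4)] VB.subspace_diff[OF spaces(4)]
  VB.subspace_neg[OF spaces(4)] VB.subspace_scale[OF spaces(4)]

lemmas expand [simp] =
  bilinear_on_rules[OF spaces(5) spaces(1,2) spaces(1,2)]
  bilinear_on_rules[OF spaces(6) spaces(3,4) spaces(3,4)]
  bilinear_on_rules[OF lA spaces(1,2) spaces(3,4)]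
  bilinear_on_rules[OF rA spaces(1,2) spaces(3,4)]
  bilinear_on_rules[OF lB spaces(3,4) spaces(1,2)]
  bilinear_on_rules[OF rB spaces(3,4) spaces(1,2)]

lemma bilinear_bowtie:
  "bilinear_on (module_prod.scale sA sB) (module_prod.scale sA sB) (module_prod.scale sA sB)
     (A \<times> B) (A \<times> B) (A \<times> B) bt"
  unfolding bilinear_on_def linear_on_def
  by (auto simp: bowtie_def VV.scale_def VA.scale_right_distrib VB.scale_right_distrib)

text \<open>
  Each element of the direct sum is the sum of its two components, and the defects of both
  identities are additive in each argument.
\<close>
lemma novikov_bowtie_iff_on_summands:
  "novikov_algebra (module_prod.scale sA sB) (A \<times> B) bt \<longleftrightarrow>
     (\<forall>x\<in>A \<times> {0} \<union> {0} \<times> B. \<forall>y\<in>A \<times> {0} \<union> {0} \<times> B. \<forall>z\<in>A \<times> {0} \<union> {0} \<times> B.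
        left_symmetric_at bt x y z \<and> right_commutative_at bt x y z)" (is "?N \<longleftrightarrow> ?H")
proof
  assume ?N
  then show ?H by (auto simp: novikov_algebra_altdef)
next
  assume ?H
  show ?N
  proof (rule novikov_identities_by_generators[where H = "A \<times> {0} \<union> {0} \<times> B"])
    show "\<exists>p\<in>A \<times> {0} \<union> {0} \<times> B. \<exists>q\<in>A \<times> {0} \<union> {0} \<times> B. w = p + q" if "w \<in> A \<times> B" for w
      using that by (intro bexI[of _ "(fst w, 0)"] bexI[of _ "(0, snd w)"]) auto
  qed (use \<open>?H\<close> VV.p.vector_space_axioms VV.subspace_Times[OF spaces(2,4)] bilinear_bowtie in auto)
qed

lemma identities_on_A:
  assumes "a \<in> A" "b \<in> A" "c \<in> A"
  shows "left_symmetric_at bt (a, 0) (b, 0) (c, 0)" "right_commutative_at bt (a, 0) (b, 0) (c, 0)"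
  using novikov_A assms
  by (auto simp: novikov_algebra_def left_symmetric_at_def right_commutative_at_def bowtie_def)

text \<open>
  For a triple with two entries in \<open>A\<close> and one in \<open>B\<close>, the \<open>B\<close>-component of an identity only involves
  how \<open>A\<close> acts on \<open>B\<close> and is an axiom of representations; the \<open>A\<close>-component mixes both actions and
  is a matched pair condition.
\<close>
lemma mixed_identities:
  assumes "a \<in> A" "b \<in> A" "x \<in> B"
  shows left_symmetric_AAB: "left_symmetric_at bt (a, 0) (b, 0) (0, x) \<longleftrightarrow>
        lA (mA a b - mA b a) x = lA a (lA b x) - lA b (lA a x) \<and>
        rB x (mA a b - mA b a) =
          rB (lA b x) a - rB (lA a x) b + mA a (rB x b) - mA b (rB x a)"
    and left_symmetric_BAA: "left_symmetric_at bt (0, x) (a, 0) (b, 0) \<longleftrightarrow>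
        lA a (rA b x) - rA b (lA a x) = rA (mA a b) x - rA b (rA a x) \<and>
        lB x (mA a b) =
          - lB (lA a x - rA a x) b + mA (lB x a - rB x a) b + rB (rA b x) a + mA a (lB x b)"
    and right_commutative_AAB: "right_commutative_at bt (a, 0) (b, 0) (0, x) \<longleftrightarrow>
        lA (mA a b) x = rA b (lA a x) \<and>
        mA (rB x a) b + lB (lA a x) b = rB x (mA a b)"
    and right_commutative_BAA: "right_commutative_at bt (0, x) (a, 0) (b, 0) \<longleftrightarrow>
        rA a (rA b x) = rA b (rA a x) \<and>
        mA (lB x a) b + lB (rA a x) b = mA (lB x b) a + lB (rA b x) a"
proof -
  have pair_eq: "p = q \<longleftrightarrow> P \<and> Q"
    if "snd p = snd q \<longleftrightarrow> P" "fst p = fst q \<longleftrightarrow> Q" for p q :: "'a \<times> 'b" and P Q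
    using that by (auto simp: prod_eq_iff)
  note [simp] = assms bowtie_def
  show "left_symmetric_at bt (a, 0) (b, 0) (0, x) \<longleftrightarrow>
        lA (mA a b - mA b a) x = lA a (lA b x) - lA b (lA a x) \<and>
        rB x (mA a b - mA b a) =
          rB (lA b x) a - rB (lA a x) b + mA a (rB x b) - mA b (rB x a)"
    unfolding left_symmetric_at_def
    by (rule pair_eq; rule diff_eq_diff_eq; simp add: algebra_simps)
  show "right_commutative_at bt (a, 0) (b, 0) (0, x) \<longleftrightarrow>
        lA (mA a b) x = rA b (lA a x) \<and>
        mA (rB x a) b + lB (lA a x) b = rB x (mA a b)"
    unfolding right_commutative_at_def
    by (rule pair_eq) (auto simp: algebra_simps)
  show "right_commutative_at bt (0, x) (a, 0) (b, 0) \<longleftrightarrow>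
        rA a (rA b x) = rA b (rA a x) \<and>
        mA (lB x a) b + lB (rA a x) b = mA (lB x b) a + lB (rA b x) a"
    unfolding right_commutative_at_def
    by (rule pair_eq) (auto simp: algebra_simps)
  \<comment> \<open>In the \<open>A\<close>-component, the term of the matched pair condition stands on the other side.\<close>
  have neg: "(u = v) = (u' = v')" if "u - v = v' - u'" for u v u' v' :: "'c::ab_group_add"
    using diff_eq_diff_eq[OF that] by auto
  show "left_symmetric_at bt (0, x) (a, 0) (b, 0) \<longleftrightarrow>
        lA a (rA b x) - rA b (lA a x) = rA (mA a b) x - rA b (rA a x) \<and>
        lB x (mA a b) =
          - lB (lA a x - rA a x) b + mA (lB x a - rB x a) b + rB (rA b x) a + mA a (lB x b)"
    unfolding left_symmetric_at_def
    by (rule pair_eq, rule diff_eq_diff_eq, simp add: algebra_simps,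
        rule neg, simp add: algebra_simps)
qed

theorem matched_pair_iff_novikov_bowtie:
  "matched_pair sA A mA sB B mB lA rA lB rB \<longleftrightarrow>
   novikov_algebra (module_prod.scale sA sB) (A \<times> B) bt"
proof -
  interpret flip: mutual_actions sB B mB sA A mA lB rB lA rA by (rule flip)
  note flip_LS = bowtie_identities_swap(1)[of mB mA lB rB lA rA "(_, _)" "(_, _)" "(_, _)", simplified]
  note flip_RC = bowtie_identities_swap(2)[of mB mA lB rB lA rA "(_, _)" "(_, _)" "(_, _)", simplified]
  note flipped_identities = flip.mixed_identities[unfolded flip_LS flip_RC]
    flip.identities_on_A[unfolded flip_LS flip_RC]
  define AAB where "AAB \<longleftrightarrow> (\<forall>a\<in>A. \<forall>b\<in>A. \<forall>x\<in>B.
      left_symmetric_at bt (a, 0) (b, 0) (0, x) \<and> left_symmetric_at bt (0, x) (a, 0) (b, 0) \<and>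
      right_commutative_at bt (a, 0) (b, 0) (0, x) \<and> right_commutative_at bt (0, x) (a, 0) (b, 0))"
  define BBA where "BBA \<longleftrightarrow> (\<forall>x\<in>B. \<forall>y\<in>B. \<forall>a\<in>A.
      left_symmetric_at bt (0, x) (0, y) (a, 0) \<and> left_symmetric_at bt (a, 0) (0, x) (0, y) \<and>
      right_commutative_at bt (0, x) (0, y) (a, 0) \<and> right_commutative_at bt (a, 0) (0, x) (0, y))"
  have "novikov_algebra (module_prod.scale sA sB) (A \<times> B) bt \<longleftrightarrow> AAB \<and> BBA"
  proof
    assume "novikov_algebra (module_prod.scale sA sB) (A \<times> B) bt"
    then show "AAB \<and> BBA"
      unfolding AAB_def BBA_def novikov_algebra_altdef by auto
  next
    assume T: "AAB \<and> BBA"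
    have AAB: "left_symmetric_at bt (a, 0) (b, 0) (0, x)" "left_symmetric_at bt (0, x) (a, 0) (b, 0)"
        "right_commutative_at bt (a, 0) (b, 0) (0, x)" "right_commutative_at bt (0, x) (a, 0) (b, 0)"
      if "a \<in> A" "b \<in> A" "x \<in> B" for a b x
      using T that unfolding AAB_def by blast+
    have BBA: "left_symmetric_at bt (0, x) (0, y) (a, 0)" "left_symmetric_at bt (a, 0) (0, x) (0, y)"
        "right_commutative_at bt (0, x) (0, y) (a, 0)" "right_commutative_at bt (a, 0) (0, x) (0, y)"
      if "x \<in> B" "y \<in> B" "a \<in> A" for a x y
      using T that unfolding BBA_def by blast+
    note sym = AAB(2)[THEN left_symmetric_at_sym[THEN iffD1]]
      AAB(3)[THEN right_commutative_at_sym[THEN iffD1]]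
      BBA(2)[THEN left_symmetric_at_sym[THEN iffD1]]
      BBA(3)[THEN right_commutative_at_sym[THEN iffD1]]
    show "novikov_algebra (module_prod.scale sA sB) (A \<times> B) bt"
      unfolding novikov_bowtie_iff_on_summands
      by (auto simp: AAB BBA sym identities_on_A flipped_identities(5,6))
  qed
  moreover have rotate: "(\<forall>x\<in>B. \<forall>y\<in>B. \<forall>a\<in>A. Q x y a) \<longleftrightarrow>
      (\<forall>a\<in>A. \<forall>x\<in>B. \<forall>y\<in>B. Q x y a)" for Q
    by blast
  moreover have "matched_pair sA A mA sB B mB lA rA lB rB \<longleftrightarrow> AAB \<and> BBA"
    using novikov_A novikov_B lA rA lB rB spaces
    unfolding matched_pair_def novikov_representation_def AAB_def BBA_def
    by (simp add: mixed_identities flipped_identities(1-4) ball_conj_distrib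
        add.commute[of "mB _ _" "lA _ _"] rotate cong: ball_cong)
      (intro iffI; elim conjE; intro conjI; assumption)
  ultimately show ?thesis by simp
qed

end


section \<open>Pairs of Novikov algebras in duality\<close>

text \<open>
  The actions are adjoint, in the pairing, to multiplications: \<open>lU\<close> to \<open>-L\<^sub>\<star>\<close> and \<open>rU\<close> to \<open>R\<close>, and
  likewise for \<open>V\<close>. All assumptions are symmetric under exchanging \<open>U\<close> and \<open>V\<close>, which is why both
  spaces are carriers and the pairing is abstract, instead of \<open>V\<close> being the dual space of \<open>U\<close>.
\<close>
locale novikov_dual_pair =
  fixes sU :: "'k::field \<Rightarrow> 'u::ab_group_add \<Rightarrow> 'u" and U :: "'u set" and mU :: "'u \<Rightarrow> 'u \<Rightarrow> 'u"
    and sV :: "'k \<Rightarrow> 'v::ab_group_add \<Rightarrow> 'v" and V :: "'v set" and mV :: "'v \<Rightarrow> 'v \<Rightarrow> 'v"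
    and pr :: "'u \<Rightarrow> 'v \<Rightarrow> 'k"
    and lU rU :: "'u \<Rightarrow> 'v \<Rightarrow> 'v" and lV rV :: "'v \<Rightarrow> 'u \<Rightarrow> 'u"
  assumes novikov_U: "novikov_algebra sU U mU"
    and novikov_V: "novikov_algebra sV V mV"
    and pr: "bilinear_on sU sV (*) U V UNIV pr"
    and separating_U: "\<lbrakk>a \<in> U; b \<in> U; \<And>f. f \<in> V \<Longrightarrow> pr a f = pr b f\<rbrakk> \<Longrightarrow> a = b"
    and separating_V: "\<lbrakk>f \<in> V; g \<in> V; \<And>a. a \<in> U \<Longrightarrow> pr a f = pr a g\<rbrakk> \<Longrightarrow> f = g"
    and lU_closed: "\<lbrakk>a \<in> U; f \<in> V\<rbrakk> \<Longrightarrow> lU a f \<in> V"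
    and rU_closed: "\<lbrakk>a \<in> U; f \<in> V\<rbrakk> \<Longrightarrow> rU a f \<in> V"
    and lV_closed: "\<lbrakk>f \<in> V; a \<in> U\<rbrakk> \<Longrightarrow> lV f a \<in> U"
    and rV_closed: "\<lbrakk>f \<in> V; a \<in> U\<rbrakk> \<Longrightarrow> rV f a \<in> U"
    and pr_lU: "\<lbrakk>a \<in> U; b \<in> U; f \<in> V\<rbrakk> \<Longrightarrow> pr b (lU a f) = - pr (mU a b + mU b a) f"
    and pr_rU: "\<lbrakk>a \<in> U; b \<in> U; f \<in> V\<rbrakk> \<Longrightarrow> pr b (rU a f) = pr (mU b a) f"
    and pr_lV: "\<lbrakk>f \<in> V; g \<in> V; a \<in> U\<rbrakk> \<Longrightarrow> pr (lV f a) g = - pr a (mV f g + mV g f)"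
    and pr_rV: "\<lbrakk>f \<in> V; g \<in> V; a \<in> U\<rbrakk> \<Longrightarrow> pr (rV f a) g = pr a (mV g f)"
begin

lemma flip: "novikov_dual_pair sV V mV sU U mU (\<lambda>f a. pr a f) lV rV lU rU"
proof
  show "bilinear_on sV sU (*) V U UNIV (\<lambda>f a. pr a f)"
    using pr by (simp add: bilinear_on_def)
qed (use novikov_U novikov_V separating_U separating_V lU_closed rU_closed lV_closed rV_closed
  pr_lU pr_rU pr_lV pr_rV in auto)

lemma spaces:
  "vector_space sU" "module.subspace sU U" "vector_space sV" "module.subspace sV V"
  "bilinear_on sU sU sU U U U mU" "bilinear_on sV sV sV V V V mV"
  using novikov_U novikov_V by (auto simp: novikov_algebra_def)

sublocale VU: vector_space sU by (fact spaces)
sublocale VV: vector_space sV by (fact spaces)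

lemmas closed [simp] =
  VU.subspace_0[OF spaces(2)] VU.subspace_add[OF spaces(2)] VU.subspace_diff[OF spaces(2)]
  VU.subspace_neg[OF spaces(2)] VU.subspace_scale[OF spaces(2)]
  VV.subspace_0[OF spaces(4)] VV.subspace_add[OF spaces(4)] VV.subspace_diff[OF spaces(4)]
  VV.subspace_neg[OF spaces(4)] VV.subspace_scale[OF spaces(4)]
  lU_closed rU_closed lV_closed rV_closed

lemmas expand [simp] =
  bilinear_on_rules[OF spaces(5) spaces(1,2) spaces(1,2)]
  bilinear_on_rules[OF spaces(6) spaces(3,4) spaces(3,4)]
  bilinear_on_rules(2-)[OF pr spaces(1,2) spaces(3,4)]

lemma eq_by_pairing:
  "\<lbrakk>a \<in> U; b \<in> U\<rbrakk> \<Longrightarrow> a = b \<longleftrightarrow> (\<forall>f\<in>V. pr a f = pr b f)"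
  "\<lbrakk>f \<in> V; g \<in> V\<rbrakk> \<Longrightarrow> f = g \<longleftrightarrow> (\<forall>a\<in>U. pr a f = pr a g)"
  using separating_U separating_V by blast+

lemma bilinear_actions_U:
  "bilinear_on sU sV sV U V V lU" "bilinear_on sU sV sV U V V rU"
  unfolding bilinear_on_def linear_on_def
  by (auto simp: eq_by_pairing pr_lU pr_rU algebra_simps)

text \<open>
  Paired with \<open>w\<close>, each axiom becomes a statement on products of \<open>a\<close>, \<open>b\<close> and \<open>w\<close>, which is a
  linear combination of Novikov identities for permutations of these three elements.
\<close>
lemma representation_U: "novikov_representation sU U mU sV V lU rU"
proof -
  have "lU (mU a b - mU b a) v = lU a (lU b v) - lU b (lU a v)" (is ?P1)
    "lU a (rU b v) - rU b (lU a v) = rU (mU a b) v - rU b (rU a v)" (is ?P2)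
    "lU (mU a b) v = rU b (lU a v)" (is ?P3)
    "rU a (rU b v) = rU b (rU a v)" (is ?P4)
    if v: "a \<in> U" "b \<in> U" "v \<in> V" for a b v
  proof -
    have LS: "pr (mU (mU x y) z) v - pr (mU x (mU y z)) v = pr (mU (mU y x) z) v - pr (mU y (mU x z)) v"
      if "x \<in> U" "y \<in> U" "z \<in> U" for x y z
    proof -
      have "mU (mU x y) z - mU x (mU y z) = mU (mU y x) z - mU y (mU x z)"
        using novikov_U that by (simp add: novikov_algebra_def)
      then have "pr (mU (mU x y) z - mU x (mU y z)) v = pr (mU (mU y x) z - mU y (mU x z)) v"
        by simp
      then show ?thesis using that v by simp
    qed
    have RC: "mU (mU x y) z = mU (mU x z) y" if "x \<in> U" "y \<in> U" "z \<in> U" for x y z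
      using novikov_U that by (simp add: novikov_algebra_def)
    note [simp] = pr_lU pr_rU v
    have RC': "pr (mU (mU x y) z) v = pr (mU (mU x z) y) v" if "x \<in> U" "y \<in> U" "z \<in> U" for x y z
      using RC[OF that] by simp
    show ?P4 using RC by (simp add: eq_by_pairing)
    have *: "pr w (lU (mU a b - mU b a) v) = pr w (lU a (lU b v) - lU b (lU a v))"
      "pr w (lU a (rU b v) - rU b (lU a v)) = pr w (rU (mU a b) v - rU b (rU a v))"
      "pr w (lU (mU a b) v) = pr w (rU b (lU a v))"
      if w: "w \<in> U" for w
    proof -
      note ids = LS[of a b w] LS[of a w b] LS[of b w a] RC'[of w a b] RC'[of a w b] RC'[of b w a]
      show "pr w (lU (mU a b - mU b a) v) = pr w (lU a (lU b v) - lU b (lU a v))"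
        using ids w v by simp algebra
      show "pr w (lU a (rU b v) - rU b (lU a v)) = pr w (rU (mU a b) v - rU b (rU a v))"
        using ids w v by simp algebra
      show "pr w (lU (mU a b) v) = pr w (rU b (lU a v))"
        using ids w v by simp algebra
    qed
    show ?P1 ?P2 ?P3
      by (rule separating_V; use * in simp)+
  qed
  then show ?thesis
    unfolding novikov_representation_def
    using spaces bilinear_actions_U by auto
qed

lemma bilinear_actions_V:
  "bilinear_on sV sU sU V U U lV" "bilinear_on sV sU sU V U U rV"
  by (fact novikov_dual_pair.bilinear_actions_U[OF flip])+

lemma representation_V: "novikov_representation sV V mV sU U lV rV"
  by (fact novikov_dual_pair.representation_U[OF flip])

lemma mutual_actions: "mutual_actions sU U mU sV V mV lU rU lV rV"
  using novikov_U novikov_V bilinear_actions_U bilinear_actions_V by unfold_locales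

lemmas action_add =
  bilinear_on_rules(2-5)[OF bilinear_actions_U(1) spaces(1-4)]
  bilinear_on_rules(2-5)[OF bilinear_actions_U(2) spaces(1-4)]
  bilinear_on_rules(2-5)[OF bilinear_actions_V(1) spaces(3,4,1,2)]
  bilinear_on_rules(2-5)[OF bilinear_actions_V(2) spaces(3,4,1,2)]

section \<open>The compatibility conditions\<close>

text \<open>
  The three bialgebra axioms, evaluated at \<open>f\<close> and \<open>g\<close>, in terms of the actions and in
  the order of their definition. Exchanging \<open>U\<close> and
  \<open>V\<close> fixes \<open>compatible_products\<close> and swaps \<open>compatible_left\<close> with \<open>compatible_right\<close>.
\<close>
definition compatible_products :: bool where
  "compatible_products \<longleftrightarrow> (\<forall>a\<in>U. \<forall>b\<in>U. \<forall>f\<in>V. \<forall>g\<in>V.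
     pr (mU a b) (mV f g) = pr (rV g a) (rU b f) + pr (lV f b) (lU a g))"

definition compatible_left :: bool where
  "compatible_left \<longleftrightarrow> (\<forall>a\<in>U. \<forall>b\<in>U. \<forall>f\<in>V. \<forall>g\<in>V.
     pr (rV g b) (lU a f) - pr (rV f b) (lU a g) = pr (rV g a) (lU b f) - pr (rV f a) (lU b g))"

definition compatible_right :: bool where
  "compatible_right \<longleftrightarrow> (\<forall>a\<in>U. \<forall>b\<in>U. \<forall>f\<in>V. \<forall>g\<in>V.
     pr (lV g b) (rU a f) - pr (lV f b) (rU a g) = pr (lV g a) (rU b f) - pr (lV f a) (rU b g))"

text \<open>
  Rewriting rules to a normal form: every scalar built from \<open>a\<close>, \<open>b\<close>, \<open>f\<close>, \<open>g\<close> that occurs when a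
  condition is paired with \<open>g\<close> becomes a combination of scalars \<open>\<langle>ab, fg\<rangle>\<close> and \<open>\<langle>X(f)a, Y(b)g\<rangle>\<close>.
  They all follow by moving the outermost operation to the other side of the pairing.
\<close>
lemma tested_conditions:
  assumes "a \<in> U" "b \<in> U" "f \<in> V" "g \<in> V"
  shows "pr (lV f (mU a b)) g = - pr (mU a b) (mV f g) - pr (mU a b) (mV g f)"
    and "pr (rV f (mU a b)) g = pr (mU a b) (mV g f)"
    and "pr (lV (lU a f) b) g = pr (lV g b) (lU a f)"
    and "pr (lV (rU a f) b) g = pr (lV g b) (rU a f)"
    and "pr (rV (lU a f) b) g = - pr (lV g b) (lU a f) - pr (rV g b) (lU a f)"
    and "pr (rV (rU a f) b) g = - pr (lV g b) (rU a f) - pr (rV g b) (rU a f)"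
    and "pr (mU (lV f a) b) g = pr (lV f a) (rU b g)"
    and "pr (mU (rV f a) b) g = pr (rV f a) (rU b g)"
    and "pr (mU b (lV f a)) g = - pr (lV f a) (lU b g) - pr (lV f a) (rU b g)"
    and "pr (mU b (rV f a)) g = - pr (rV f a) (lU b g) - pr (rV f a) (rU b g)"
proof -
  note [simp] = assms
  show "pr (lV f (mU a b)) g = - pr (mU a b) (mV f g) - pr (mU a b) (mV g f)"
    and "pr (rV f (mU a b)) g = pr (mU a b) (mV g f)"
    and "pr (lV (lU a f) b) g = pr (lV g b) (lU a f)"
    and "pr (lV (rU a f) b) g = pr (lV g b) (rU a f)"
    and "pr (rV (lU a f) b) g = - pr (lV g b) (lU a f) - pr (rV g b) (lU a f)"
    and "pr (rV (rU a f) b) g = - pr (lV g b) (rU a f) - pr (rV g b) (rU a f)"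
    by (simp_all add: pr_lV pr_rV)
  show "pr (mU (lV f a) b) g = pr (lV f a) (rU b g)"
    and "pr (mU (rV f a) b) g = pr (rV f a) (rU b g)"
    and "pr (mU b (lV f a)) g = - pr (lV f a) (lU b g) - pr (lV f a) (rU b g)"
    and "pr (mU b (rV f a)) g = - pr (rV f a) (lU b g) - pr (rV f a) (rU b g)"
    by (simp_all add: pr_lU pr_rU)
qed

text \<open>
  The conditions that come from right commutativity of the product on the direct sum are already in
  normal form equal to compatibility conditions, whereas those that come from left symmetry
  combine two of them.
\<close>
lemma right_commutative_VUU_iff:
  "(\<forall>a\<in>U. \<forall>b\<in>U. \<forall>f\<in>V. mU (lV f a) b + lV (rU a f) b = mU (lV f b) a + lV (rU b f) a) \<longleftrightarrow>
   compatible_right"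
proof -
  have "mU (lV f a) b + lV (rU a f) b = mU (lV f b) a + lV (rU b f) a \<longleftrightarrow>
    (\<forall>g\<in>V. pr (lV g b) (rU a f) - pr (lV f b) (rU a g) = pr (lV g a) (rU b f) - pr (lV f a) (rU b g))"
    if "a \<in> U" "b \<in> U" "f \<in> V" for a b f
    using that by (auto simp: eq_by_pairing tested_conditions action_add algebra_simps)
  then show ?thesis
    unfolding compatible_right_def by (simp cong: ball_cong)
qed

lemma right_commutative_UUV_iff:
  "(\<forall>a\<in>U. \<forall>b\<in>U. \<forall>f\<in>V. mU (rV f a) b + lV (lU a f) b = rV f (mU a b)) \<longleftrightarrow> compatible_products"
proof -
  have "mU (rV f a) b + lV (lU a f) b = rV f (mU a b) \<longleftrightarrow>
    (\<forall>g\<in>V. pr (mU a b) (mV g f) = pr (rV f a) (rU b g) + pr (lV g b) (lU a f))"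
    if "a \<in> U" "b \<in> U" "f \<in> V" for a b f
    using that by (auto simp: eq_by_pairing tested_conditions action_add algebra_simps)
  then show ?thesis
    unfolding compatible_products_def by (auto cong: ball_cong)
qed

text \<open>
  Here \<open>compatible_products\<close> removes both products \<open>\<langle>ab, fg\<rangle>\<close> and \<open>\<langle>ab, gf\<rangle>\<close>, and what is left
  is \<open>compatible_right\<close>. In the same way the next lemma leaves \<open>compatible_left\<close>.
\<close>
lemma left_symmetric_VUU:
  assumes compatible_products compatible_right "a \<in> U" "b \<in> U" "f \<in> V"
  shows "lV f (mU a b) =
    - lV (lU a f - rU a f) b + mU (lV f a - rV f a) b + rV (rU b f) a + mU a (lV f b)"
proof (rule separating_U)
  fix g assume g: "g \<in> V"
  have P: "pr (mU a b) (mV f g) = pr (rV g a) (rU b f) + pr (lV f b) (lU a g)"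
    "pr (mU a b) (mV g f) = pr (rV f a) (rU b g) + pr (lV g b) (lU a f)"
    using assms g unfolding compatible_products_def by blast+
  have R: "pr (lV g b) (rU a f) - pr (lV f b) (rU a g) = pr (lV g a) (rU b f) - pr (lV f a) (rU b g)"
    using assms g unfolding compatible_right_def by blast
  show "pr (lV f (mU a b)) g =
    pr (- lV (lU a f - rU a f) b + mU (lV f a - rV f a) b + rV (rU b f) a + mU a (lV f b)) g"
    using P R assms g by (simp add: tested_conditions action_add) algebra
qed (use assms in simp_all)

lemma left_symmetric_UUV:
  assumes compatible_products compatible_left "a \<in> U" "b \<in> U" "f \<in> V"
  shows "rV f (mU a b - mU b a) =
    rV (lU b f) a - rV (lU a f) b + mU a (rV f b) - mU b (rV f a)"
proof (rule separating_U)
  fix g assume g: "g \<in> V"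
  have P: "pr (mU a b) (mV g f) = pr (rV f a) (rU b g) + pr (lV g b) (lU a f)"
    "pr (mU b a) (mV g f) = pr (rV f b) (rU a g) + pr (lV g a) (lU b f)"
    using assms g unfolding compatible_products_def by blast+
  have L: "pr (rV g b) (lU a f) - pr (rV f b) (lU a g) = pr (rV g a) (lU b f) - pr (rV f a) (lU b g)"
    using assms g unfolding compatible_left_def by blast
  show "pr (rV f (mU a b - mU b a)) g =
    pr (rV (lU b f) a - rV (lU a f) b + mU a (rV f b) - mU b (rV f a)) g"
    using P L assms g by (simp add: tested_conditions action_add) algebra
qed (use assms in simp_all)

lemma compatible_flip:
  "novikov_dual_pair.compatible_products V mV U mU (\<lambda>f a. pr a f) lV rV lU rU \<longleftrightarrow> compatible_products"
  "novikov_dual_pair.compatible_left V U (\<lambda>f a. pr a f) lV rU \<longleftrightarrow> compatible_right"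
  "novikov_dual_pair.compatible_right V U (\<lambda>f a. pr a f) rV lU \<longleftrightarrow> compatible_left"
proof -
  interpret flip: novikov_dual_pair sV V mV sU U mU "\<lambda>f a. pr a f" lV rV lU rU
    by (rule flip)
  show "flip.compatible_products \<longleftrightarrow> compatible_products"
    unfolding compatible_products_def flip.compatible_products_def
    by (auto simp: add.commute)
  show "flip.compatible_left \<longleftrightarrow> compatible_right"
    unfolding compatible_right_def flip.compatible_left_def
    by (auto simp: algebra_simps; metis add.commute)
  show "flip.compatible_right \<longleftrightarrow> compatible_left"
    unfolding compatible_left_def flip.compatible_right_def
    by (auto simp: algebra_simps; metis add.commute)
qed

text \<open>
  The right commutativity conditions for two elements of \<open>U\<close> give \<open>compatible_products\<close> and
  \<open>compatible_right\<close>; exchanging \<open>U\<close> and \<open>V\<close>, those for two elements of \<open>V\<close> give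
  \<open>compatible_products\<close> again and \<open>compatible_left\<close>.
\<close>
theorem matched_pair_iff_compatible:
  "matched_pair sU U mU sV V mV lU rU lV rV \<longleftrightarrow>
   compatible_products \<and> compatible_left \<and> compatible_right"
proof -
  interpret flip: novikov_dual_pair sV V mV sU U mU "\<lambda>f a. pr a f" lV rV lU rU
    by (rule flip)
  have right_commutative_UVV_iff:
    "(\<forall>a\<in>U. \<forall>f\<in>V. \<forall>g\<in>V. lU (rV f a) g + mV (lU a f) g = lU (rV g a) f + mV (lU a g) f) \<longleftrightarrow>
      compatible_left"
    using flip.right_commutative_VUU_iff unfolding compatible_flip
    by (simp add: add.commute[of "mV _ _"]) blast
  have right_commutative_VVU_iff:
    "(\<forall>a\<in>U. \<forall>f\<in>V. \<forall>g\<in>V. lU (lV f a) g + mV (rU a f) g = rU a (mV f g)) \<longleftrightarrow>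
      compatible_products"
    using flip.right_commutative_UUV_iff unfolding compatible_flip
    by (simp add: add.commute[of "mV _ _"]) blast
  show ?thesis
  proof
    assume "matched_pair sU U mU sV V mV lU rU lV rV"
    then show "compatible_products \<and> compatible_left \<and> compatible_right"
      unfolding matched_pair_def right_commutative_VUU_iff right_commutative_UUV_iff
        right_commutative_UVV_iff by blast
  next
    assume "compatible_products \<and> compatible_left \<and> compatible_right"
    then show "matched_pair sU U mU sV V mV lU rU lV rV"
      unfolding matched_pair_def right_commutative_VUU_iff right_commutative_UUV_iff
        right_commutative_UVV_iff right_commutative_VVU_iff
      using novikov_U novikov_V representation_U representation_V
        left_symmetric_VUU left_symmetric_UUV flip.left_symmetric_VUU flip.left_symmetric_UUV
      by (simp add: compatible_flip)
  qed
qed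

section \<open>Invariant products\<close>

definition form :: "'u \<times> 'v \<Rightarrow> 'u \<times> 'v \<Rightarrow> 'k" where
  "form x y = pr (fst y) (snd x) + pr (fst x) (snd y)"

abbreviation double_product where "double_product \<equiv> bowtie mU mV lU rU lV rV"

definition invariant :: "('u \<times> 'v \<Rightarrow> 'u \<times> 'v \<Rightarrow> 'u \<times> 'v) \<Rightarrow> bool" where
  "invariant M \<longleftrightarrow> (\<forall>x\<in>U \<times> V. \<forall>y\<in>U \<times> V. \<forall>z\<in>U \<times> V. form (M x y) z = - form y (M x z + M z x))"

lemma invariant_double_product: "invariant double_product"
  unfolding invariant_def
  by (auto simp: form_def bowtie_def pr_lU pr_rU pr_lV pr_rV algebra_simps)

text \<open>
  The form is nondegenerate, so \<open>af\<close> is determined by the values \<open>B(af, z)\<close> with \<open>z\<close> in one of the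
  summands. For \<open>z = b\<close> in \<open>U\<close> invariance gives \<open>-B(f, ab+ba)\<close>, and for \<open>z = g\<close> in \<open>V\<close> the
  consequence \<open>B(yx,z) = B(y,zx)\<close> gives \<open>B(a, gf)\<close>; both only use products inside a summand.
\<close>
lemma invariant_unique:
  assumes M: "bilinear_on s s s (U \<times> V) (U \<times> V) (U \<times> V) M" and "invariant M"
    and MU: "\<And>a b. \<lbrakk>a \<in> U; b \<in> U\<rbrakk> \<Longrightarrow> M (a, 0) (b, 0) = (mU a b, 0)"
    and MV: "\<And>f g. \<lbrakk>f \<in> V; g \<in> V\<rbrakk> \<Longrightarrow> M (0, f) (0, g) = (0, mV f g)"
    and "x \<in> U \<times> V" "y \<in> U \<times> V"
  shows "M x y = double_product x y"
proof -
  have closed: "M x y \<in> U \<times> V" if "x \<in> U \<times> V" "y \<in> U \<times> V" for x y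
    using M that by (auto simp: bilinear_on_def linear_on_def)
  have add: "M (x + x') y = M x y + M x' y" "M y (x + x') = M y x + M y x'"
    if "x \<in> U \<times> V" "x' \<in> U \<times> V" "y \<in> U \<times> V" for x x' y
    using M that unfolding bilinear_on_def linear_on_def by blast+
  have inv: "form (M x y) z = - form y (M x z + M z x)"
    if "x \<in> U \<times> V" "y \<in> U \<times> V" "z \<in> U \<times> V" for x y z
    using \<open>invariant M\<close> that unfolding invariant_def by blast
  have form_add: "form x (y + z) = form x y + form x z"
    if "x \<in> U \<times> V" "y \<in> U \<times> V" "z \<in> U \<times> V" for x y z
    using that by (auto simp: form_def)
  have form_commute: "form x y = form y x" for x y
    by (simp add: form_def)
  \<comment> \<open>Compare the invariance identities for \<open>(x, y, z)\<close> and \<open>(x, z, y)\<close>; the form is symmetric.\<close>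
  have inv': "form (M y x) z = form y (M z x)"
    if "x \<in> U \<times> V" "y \<in> U \<times> V" "z \<in> U \<times> V" for x y z
  proof -
    have "form (M x y) z = - form y (M x z) - form y (M z x)"
      "form (M x z) y = - form z (M x y) - form z (M y x)"
      using that inv closed by (simp_all add: form_add)
    then show ?thesis
      by (simp add: form_commute[of z] form_commute[of y "M x z"] algebra_simps)
  qed
  have UV: "M (a, 0) (0, g) = (rV g a, lU a g)" if "a \<in> U" "g \<in> V" for a g
  proof -
    obtain p q where pq: "M (a, 0) (0, g) = (p, q)" "p \<in> U" "q \<in> V"
      using closed[of "(a, 0)" "(0, g)"] \<open>a \<in> U\<close> \<open>g \<in> V\<close> by (cases "M (a, 0) (0, g)") auto
    have "q = lU a g"
      using inv[of "(a, 0)" "(0, g)" "(_, 0)"] that pq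
      by (intro separating_V) (auto simp: MU form_def pr_lU)
    moreover have "p = rV g a"
      using inv'[of "(0, g)" "(a, 0)" "(0, _)"] that pq
      by (intro separating_U) (auto simp: MV form_def pr_rV)
    ultimately show ?thesis using pq by simp
  qed
  have VU: "M (0, f) (b, 0) = (lV f b, rU b f)" if "f \<in> V" "b \<in> U" for f b
  proof -
    obtain p q where pq: "M (0, f) (b, 0) = (p, q)" "p \<in> U" "q \<in> V"
      using closed[of "(0, f)" "(b, 0)"] \<open>f \<in> V\<close> \<open>b \<in> U\<close> by (cases "M (0, f) (b, 0)") auto
    have "p = lV f b"
      using inv[of "(0, f)" "(b, 0)" "(0, _)"] that pq
      by (intro separating_U) (auto simp: MV form_def pr_lV)
    moreover have "q = rU b f"
      using inv'[of "(b, 0)" "(0, f)" "(_, 0)"] that pq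
      by (intro separating_V) (auto simp: MU form_def pr_rU)
    ultimately show ?thesis using pq by simp
  qed
  obtain a f b g where xy: "x = (a, f)" "y = (b, g)" "a \<in> U" "b \<in> U" "f \<in> V" "g \<in> V"
    using assms by auto
  have "M x y = M ((a, 0) + (0, f)) ((b, 0) + (0, g))" by (simp add: xy)
  also have "\<dots> = M (a, 0) ((b, 0) + (0, g)) + M (0, f) ((b, 0) + (0, g))"
    using xy by (intro add) auto
  also have "\<dots> = M (a, 0) (b, 0) + M (a, 0) (0, g) + (M (0, f) (b, 0) + M (0, f) (0, g))"
    using xy by (intro arg_cong2[where f = "(+)"] add) auto
  also have "\<dots> = double_product x y"
    using xy by (simp add: MU MV UV VU bowtie_def algebra_simps)
  finally show ?thesis .
qed

theorem invariant_novikov_iff_matched_pair: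
  "(\<exists>M. novikov_algebra (module_prod.scale sU sV) (U \<times> V) M \<and>
        (\<forall>a\<in>U. \<forall>b\<in>U. M (a, 0) (b, 0) = (mU a b, 0)) \<and>
        (\<forall>f\<in>V. \<forall>g\<in>V. M (0, f) (0, g) = (0, mV f g)) \<and> invariant M) \<longleftrightarrow>
   matched_pair sU U mU sV V mV lU rU lV rV" (is "?L \<longleftrightarrow> ?R")
proof -
  interpret act: mutual_actions sU U mU sV V mV lU rU lV rV by (rule mutual_actions)
  note act.closed [simp] act.expand [simp]
  show ?thesis
  proof
    assume ?L
    then obtain M where M: "novikov_algebra (module_prod.scale sU sV) (U \<times> V) M" "invariant M"
      "\<And>a b. \<lbrakk>a \<in> U; b \<in> U\<rbrakk> \<Longrightarrow> M (a, 0) (b, 0) = (mU a b, 0)"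
      "\<And>f g. \<lbrakk>f \<in> V; g \<in> V\<rbrakk> \<Longrightarrow> M (0, f) (0, g) = (0, mV f g)"
      by blast
    have bil: "bilinear_on (module_prod.scale sU sV) (module_prod.scale sU sV)
      (module_prod.scale sU sV) (U \<times> V) (U \<times> V) (U \<times> V) M"
      using M(1) by (simp add: novikov_algebra_def)
    have eq: "double_product x y = M x y" if "x \<in> U \<times> V" "y \<in> U \<times> V" for x y
      using invariant_unique[OF bil M(2-4) that] by simp
    have closed: "M x y \<in> U \<times> V" if "x \<in> U \<times> V" "y \<in> U \<times> V" for x y
      using bil that by (auto simp: bilinear_on_def linear_on_def)
    have "novikov_algebra (module_prod.scale sU sV) (U \<times> V) double_product"
      unfolding novikov_algebra_altdef left_symmetric_at_def right_commutative_at_def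
    proof (intro conjI ballI)
      fix x y z assume xyz: "x \<in> U \<times> V" "y \<in> U \<times> V" "z \<in> U \<times> V"
      then show "double_product (double_product x y) z - double_product x (double_product y z) =
          double_product (double_product y x) z - double_product y (double_product x z)"
        using M(1) unfolding novikov_algebra_def by (simp only: eq closed)
      show "double_product (double_product x y) z = double_product (double_product x z) y"
        using M(1) xyz unfolding novikov_algebra_def by (simp only: eq closed)
    qed (use M(1) act.bilinear_bowtie in \<open>auto simp: novikov_algebra_def\<close>)
    then show ?R by (simp add: act.matched_pair_iff_novikov_bowtie)
  next
    assume ?R
    then show ?L
      by (intro exI[of _ double_product])
        (auto simp: act.matched_pair_iff_novikov_bowtie invariant_double_product, auto simp: bowtie_def)
  qed
qed

end


section \<open>The dual of a Novikov coalgebra\<close>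

lemma dual_iff:
  assumes "vector_space smul"
  shows "f \<in> dual smul \<longleftrightarrow> (\<forall>a b. f (a + b) = f a + f b) \<and> (\<forall>c a. f (smul c a) = c * f a)"
  by (auto simp: dual_def Vector_Spaces.linear_iff assms vector_space_mult)

lemma subspace_dual:
  assumes "vector_space smul"
  shows "module.subspace dual_scale (dual smul)"
proof -
  interpret D: vector_space "dual_scale :: 'a \<Rightarrow> ('b \<Rightarrow> 'a) \<Rightarrow> _"
    by (intro vector_space_fun_scale vector_space_mult)
  show ?thesis
    unfolding D.subspace_def
    by (auto simp: dual_iff[OF assms] fun_scale_def algebra_simps)
qed

lemma tensor2_bilinear:
  assumes "vector_space smul" "t \<in> tensor2_space smul"
  shows "bilinear_on dual_scale dual_scale (*) (dual smul) (dual smul) UNIV t"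
proof -
  interpret T: vector_space tensor2_scale
    by (intro vector_space_fun_scale vector_space_mult)
  interpret D: vector_space "dual_scale :: 'a \<Rightarrow> ('b \<Rightarrow> 'a) \<Rightarrow> _"
    by (intro vector_space_fun_scale vector_space_mult)
  note [simp] = D.subspace_add[OF subspace_dual[OF assms(1)]]
    D.subspace_scale[OF subspace_dual[OF assms(1)]]
  have scale: "tensor2_scale c t f g = c * t f g" "dual_scale c f a = c * f a"
    for c and t :: "('a, 'b) tensor2" and f g a
    by (simp_all add: fun_scale_def)
  show ?thesis
    using assms(2) unfolding tensor2_space_def
  proof (induction rule: T.span_induct_alt)
    case base
    show ?case by (simp add: bilinear_on_def linear_on_def)
  next
    case (step c x y)
    then obtain a b where "x = pure2 smul a b" by blast
    with step(2) show ?case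
      unfolding bilinear_on_def linear_on_def
      by (simp add: scale pure2_def algebra_simps)
  qed
qed

text \<open>
  In the model of tensors as forms on the dual, \<open>(id \<otimes> \<Delta>)\<Delta>(a)\<close> evaluated at \<open>f, g, h\<close> is
  \<open>(f \<cdot> (g \<cdot> h))(a)\<close>, and \<open>(\<Delta> \<otimes> id)\<Delta>(a)\<close> is \<open>((f \<cdot> g) \<cdot> h)(a)\<close>. So the two coalgebra axioms are
  literally left symmetry and right commutativity of the product on the dual.
\<close>
lemma novikov_algebra_dual:
  assumes "vector_space smul" "novikov_coalgebra smul \<Delta>"
  shows "novikov_algebra dual_scale (dual smul) (dual_mult \<Delta>)"
proof -
  have lin: "Vector_Spaces.linear smul tensor2_scale \<Delta>" and range: "\<And>a. \<Delta> a \<in> tensor2_space smul"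
    and co: "id_tensor \<Delta> (\<Delta> a) - swap_id (id_tensor \<Delta> (\<Delta> a)) =
          tensor_id \<Delta> (\<Delta> a) - swap_id (tensor_id \<Delta> (\<Delta> a))"
      "swap_id (id_tensor \<Delta> (swap (\<Delta> a))) = tensor_id \<Delta> (\<Delta> a)" for a
    using assms(2) by (auto simp: novikov_coalgebra_def)
  have bil: "bilinear_on dual_scale dual_scale dual_scale (dual smul) (dual smul) (dual smul)
      (dual_mult \<Delta>)"
    using tensor2_bilinear[OF assms(1) range] coproduct_functional[OF lin]
    unfolding bilinear_on_def linear_on_def dual_mult_def
    by (auto simp: fun_scale_def fun_eq_iff)
  have "dual_mult \<Delta> (dual_mult \<Delta> f g) h - dual_mult \<Delta> f (dual_mult \<Delta> g h) =
      dual_mult \<Delta> (dual_mult \<Delta> g f) h - dual_mult \<Delta> g (dual_mult \<Delta> f h)" for f g h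
  proof
    fix a
    show "(dual_mult \<Delta> (dual_mult \<Delta> f g) h - dual_mult \<Delta> f (dual_mult \<Delta> g h)) a =
      (dual_mult \<Delta> (dual_mult \<Delta> g f) h - dual_mult \<Delta> g (dual_mult \<Delta> f h)) a"
      using co(1)[of a, THEN fun_cong, THEN fun_cong, THEN fun_cong, of f g h]
      by (simp add: id_tensor_def tensor_id_def swap_id_def dual_mult_def) algebra
  qed
  moreover have "dual_mult \<Delta> (dual_mult \<Delta> f g) h = dual_mult \<Delta> (dual_mult \<Delta> f h) g" for f g h
  proof
    fix a
    show "dual_mult \<Delta> (dual_mult \<Delta> f g) h a = dual_mult \<Delta> (dual_mult \<Delta> f h) g a"
      using co(2)[of a, THEN fun_cong, THEN fun_cong, THEN fun_cong, of f g h]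
      by (simp add: id_tensor_def tensor_id_def swap_id_def swap_def dual_mult_def)
  qed
  ultimately show ?thesis
    unfolding novikov_algebra_def
    using bil subspace_dual[OF assms(1)] vector_space_fun_scale[OF vector_space_mult] by auto
qed

section \<open>Novikov bialgebras\<close>

lemma (in finite_dimensional_vector_space) dual_separates:
  assumes "\<And>f. f \<in> dual scale \<Longrightarrow> f a = f b"
  shows "a = b"
proof -
  have "representation Basis a e = representation Basis b e" for e
    using assms[OF coordinate_in_dual] .
  then have "(\<Sum>e\<in>Basis. scale (representation Basis a e) e) =
      (\<Sum>e\<in>Basis. scale (representation Basis b e) e)"
    by (simp only:)
  then show ?thesis
    unfolding coordinate_expansion .
qed

locale novikov_algebra_coalgebra = finite_dimensional_vector_space scale Basis
  for scale :: "'k::field \<Rightarrow> 'a::ab_group_add \<Rightarrow> 'a" (infixr "*s" 75) and Basis +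
  fixes m :: "'a \<Rightarrow> 'a \<Rightarrow> 'a" and \<Delta> :: "'a \<Rightarrow> ('k, 'a) tensor2"
  assumes novikov: "novikov_algebra scale UNIV m"
    and conovikov: "novikov_coalgebra scale \<Delta>"
begin

abbreviation "lA \<equiv> dual_rep (L_star m) :: 'a \<Rightarrow> ('a \<Rightarrow> 'k) \<Rightarrow> 'a \<Rightarrow> 'k"
abbreviation "rA \<equiv> \<lambda>a (f :: 'a \<Rightarrow> 'k). - dual_rep (R_mult m) a f"
abbreviation "lD \<equiv> bidual_rep scale (L_star (dual_mult \<Delta>))"
abbreviation "rD \<equiv> \<lambda>f a. - bidual_rep scale (R_mult (dual_mult \<Delta>)) f a"

lemmas dual_novikov = novikov_algebra_dual[OF vector_space_axioms conovikov]
lemmas dual_iff = dual_iff[OF vector_space_axioms]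

text \<open>
  Linearity of \<open>\<phi> f\<close> guarantees that the image functional is represented by an element of \<open>A\<close>.
\<close>
lemma bidual_rep_pairing:
  assumes "linear_on dual_scale dual_scale (dual scale) (dual scale) (\<phi> f)" "g \<in> dual scale"
  shows "g (bidual_rep scale \<phi> f a) = - \<phi> f g a"
proof -
  have "\<forall>g\<in>dual scale. g (bidual_rep scale \<phi> f a) = dual_rep \<phi> f (\<lambda>g'. g' a) g"
    unfolding bidual_rep_def
    by (rule theI'[OF bidual_rep_unique_existence[where \<phi> = \<phi> and f = f and a = a, OF assms(1)]])
  then have "g (bidual_rep scale \<phi> f a) = dual_rep \<phi> f (\<lambda>g'. g' a) g"
    using assms(2) by (rule bspec)
  then show ?thesis by (simp only: dual_rep_def)
qed

lemma lD_rD_pairing: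
  assumes "f \<in> dual scale" "g \<in> dual scale"
  shows "g (lD f a) = - (dual_mult \<Delta> f g a + dual_mult \<Delta> g f a)"
    and "g (rD f a) = dual_mult \<Delta> g f a"
proof -
  have mult: "linear_on dual_scale dual_scale (dual scale) (dual scale) (dual_mult \<Delta> f)"
    "linear_on dual_scale dual_scale (dual scale) (dual scale) (\<lambda>g. dual_mult \<Delta> g f)"
    using dual_novikov assms(1) by (auto simp: novikov_algebra_def bilinear_on_def)
  interpret D: vector_space "dual_scale :: 'k \<Rightarrow> ('a \<Rightarrow> 'k) \<Rightarrow> _"
    by (intro vector_space_fun_scale vector_space_mult)
  have "linear_on dual_scale dual_scale (dual scale) (dual scale) (L_star (dual_mult \<Delta>) f)"
    using mult unfolding linear_on_def L_star_def
    by (simp add: D.subspace_add[OF subspace_dual[OF vector_space_axioms]] D.scale_right_distrib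
        add_ac)
  then show "g (lD f a) = - (dual_mult \<Delta> f g a + dual_mult \<Delta> g f a)"
    using assms by (simp add: bidual_rep_pairing L_star_def)
  have "linear_on dual_scale dual_scale (dual scale) (dual scale) (R_mult (dual_mult \<Delta>) f)"
    using mult(2) by (simp add: R_mult_def linear_on_def)
  then have "g (bidual_rep scale (R_mult (dual_mult \<Delta>)) f a) = - dual_mult \<Delta> g f a"
    using assms by (simp add: bidual_rep_pairing R_mult_def)
  moreover have "g (- x) = - g x" for x
    using assms(2) module_hom.neg[of scale "(*)" g]
    by (simp add: dual_def Vector_Spaces.linear_def)
  ultimately show "g (rD f a) = dual_mult \<Delta> g f a" by simp
qed

lemma mult_add: "m (a + b) c = m a c + m b c" "m c (a + b) = m c a + m c b"
  "m (k *s a) b = k *s m a b" "m a (k *s b) = k *s m a b"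
  using novikov by (auto simp: novikov_algebra_def bilinear_on_def linear_on_def)

sublocale pair: novikov_dual_pair scale UNIV m dual_scale "dual scale" "dual_mult \<Delta>"
  "\<lambda>a f. f a" lA rA lD rD
proof
  show "bilinear_on scale dual_scale (*) UNIV (dual scale) UNIV (\<lambda>a f. f a)"
    unfolding bilinear_on_def linear_on_def by (auto simp: dual_iff fun_scale_def)
  show "a = b" if "\<And>f. f \<in> dual scale \<Longrightarrow> f a = f b" for a b
    using dual_separates that by blast
  show "lA a f \<in> dual scale" "rA a f \<in> dual scale" if "f \<in> dual scale" for a f
    using that
    by (auto simp: dual_iff dual_rep_def L_star_def R_mult_def mult_add algebra_simps)
  show "lA a f b = - f (m a b + m b a)" "rA a f b = f (m b a)" for a b f
    by (simp_all add: dual_rep_def L_star_def R_mult_def)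
  show "f = g" if "\<And>a. a \<in> UNIV \<Longrightarrow> f a = g a" for f g :: "'a \<Rightarrow> 'k"
    using that by auto
  show "g (lD f a) = - (dual_mult \<Delta> f g + dual_mult \<Delta> g f) a"
    if "f \<in> dual scale" "g \<in> dual scale" for f g a
    using lD_rD_pairing(1)[OF that] by simp
  show "g (rD f a) = dual_mult \<Delta> g f a"
    if "f \<in> dual scale" "g \<in> dual scale" for f g a
    using lD_rD_pairing(2)[OF that] .
qed (rule novikov dual_novikov UNIV_I)+

lemma manin_triple_iff_matched_pair:
  "(\<exists>M. manin_triple scale m (dual_mult \<Delta>) M) \<longleftrightarrow>
   matched_pair scale UNIV m dual_scale (dual scale) (dual_mult \<Delta>) lA rA lD rD"
  unfolding pair.invariant_novikov_iff_matched_pair[symmetric] manin_triple_def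
    pair.invariant_def pair.form_def manin_form_def
  by (simp only: ball_UNIV conj_assoc)

text \<open>
  Both sides of a bialgebra axiom vanish outside the dual space, so it may be tested on functionals
  \<open>f\<close>, \<open>g\<close> in the dual. There \<open>\<phi> \<otimes> \<psi>\<close> acts by precomposing \<open>f\<close> with \<open>\<phi>\<close> and \<open>g\<close> with
  \<open>\<psi>\<close>, and precomposition with \<open>R(a)\<close> and \<open>L\<^sub>\<star>(a)\<close> is \<open>rA a\<close> and \<open>- lA a\<close>. Hence each of the
  terms is, up to sign, one scalar of a compatibility condition.
\<close>
lemma bialgebra_iff_compatible:
  "novikov_bialgebra scale m \<Delta> \<longleftrightarrow>
   pair.compatible_products \<and> pair.compatible_left \<and> pair.compatible_right"
proof -
  have outside: "\<Delta> a f g = 0" if "f \<notin> dual scale \<or> g \<notin> dual scale" for a f g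
    using conovikov that tensor2_outside_dual[of "\<Delta> a" scale f g]
    by (auto simp: novikov_coalgebra_def)
  have on_dual: "s = t \<longleftrightarrow> (\<forall>f\<in>dual scale. \<forall>g\<in>dual scale. s f g = t f g)"
    if "\<And>f g. f \<notin> dual scale \<or> g \<notin> dual scale \<Longrightarrow> s f g = 0 \<and> t f g = 0"
    for s t :: "('k, 'a) tensor2"
  proof
    assume eq: "\<forall>f\<in>dual scale. \<forall>g\<in>dual scale. s f g = t f g"
    show "s = t"
    proof (intro ext)
      fix f g show "s f g = t f g"
        using eq that[of f g] by (cases "f \<in> dual scale \<and> g \<in> dual scale") auto
    qed
  qed simp
  have comp: "f \<circ> R_mult m a = rA a f" "f \<circ> L_star m a = - lA a f" for a and f :: "'a \<Rightarrow> 'k"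
    by (auto simp: fun_eq_iff dual_rep_def)
  have neg: "\<Delta> b (- f) g = - \<Delta> b f g" "\<Delta> b g (- f) = - \<Delta> b g f"
    if "f \<in> dual scale" "g \<in> dual scale" for b f g
    using that bilinear_on_rules(8,9)[OF pair.spaces(6) pair.spaces(3,4) pair.spaces(3,4)]
    by (auto simp: dual_mult_def fun_eq_iff)
  have terms:
    "tensor_map scale (R_mult m b) id (\<Delta> a) f g = rA b f (rD g a)"
    "tensor_map scale id (L_star m a) (\<Delta> b + swap (\<Delta> b)) f g = lA a g (lD f b)"
    "tensor_map scale (L_star m a) id (\<Delta> b) f g = - lA a f (rD g b)"
    "tensor_map scale id (L_star m a) (swap (\<Delta> b)) f g = - lA a g (rD f b)"
    "tensor_map scale id (R_mult m a) (\<Delta> b + swap (\<Delta> b)) f g = - rA a g (lD f b)"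
    "tensor_map scale (R_mult m a) id (\<Delta> b + swap (\<Delta> b)) f g = - rA a f (lD g b)"
    if fg: "f \<in> dual scale" "g \<in> dual scale" for a b f g
  proof -
    have act: "lA a f \<in> dual scale" "rA a f \<in> dual scale" if "f \<in> dual scale" for a f
      using pair.lU_closed pair.rU_closed that by auto
    have mult: "\<Delta> b f g = f (rD g b)" "f (lD g b) = - (\<Delta> b f g + \<Delta> b g f)"
      if "f \<in> dual scale" "g \<in> dual scale" for f g b
      using lD_rD_pairing[of g f b] that by (auto simp: dual_mult_def add.commute)
    show "tensor_map scale (R_mult m b) id (\<Delta> a) f g = rA b f (rD g a)"
      "tensor_map scale id (L_star m a) (\<Delta> b + swap (\<Delta> b)) f g = lA a g (lD f b)"
      "tensor_map scale (L_star m a) id (\<Delta> b) f g = - lA a f (rD g b)"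
      "tensor_map scale id (L_star m a) (swap (\<Delta> b)) f g = - lA a g (rD f b)"
      "tensor_map scale id (R_mult m a) (\<Delta> b + swap (\<Delta> b)) f g = - rA a g (lD f b)"
      "tensor_map scale (R_mult m a) id (\<Delta> b + swap (\<Delta> b)) f g = - rA a f (lD g b)"
      unfolding tensor_map_def swap_def comp plus_fun_apply id_comp comp_id if_True simp_thms
        neg[OF act(1)[OF fg(1)] fg(2)] neg[OF act(1)[OF fg(2)] fg(1)]
      by (simp_all add: fg act mult del: uminus_apply minus_apply)
  qed
  have zero: "tensor_map scale \<phi> \<psi> t f g = 0"
    if "f \<notin> dual scale \<or> g \<notin> dual scale" for \<phi> \<psi> t f g
    using that by (auto simp: tensor_map_def)
  have "(\<forall>a b. \<Delta> (m a b) = tensor_map scale (R_mult m b) id (\<Delta> a) +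
        tensor_map scale id (L_star m a) (\<Delta> b + swap (\<Delta> b))) \<longleftrightarrow> pair.compatible_products"
    unfolding pair.compatible_products_def
    by (subst on_dual) (simp_all add: outside zero terms dual_mult_def del: uminus_apply)
  moreover have "(\<forall>a b.
        tensor_map scale (L_star m a) id (\<Delta> b) - tensor_map scale id (L_star m a) (swap (\<Delta> b)) =
        tensor_map scale (L_star m b) id (\<Delta> a) - tensor_map scale id (L_star m b) (swap (\<Delta> a))) \<longleftrightarrow>
      pair.compatible_left"
    unfolding pair.compatible_left_def
    by (subst on_dual) (simp_all add: zero terms algebra_simps del: uminus_apply, metis)
  moreover have "(\<forall>a b.
        tensor_map scale id (R_mult m a) (\<Delta> b + swap (\<Delta> b)) -
        tensor_map scale (R_mult m a) id (\<Delta> b + swap (\<Delta> b)) =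
        tensor_map scale id (R_mult m b) (\<Delta> a + swap (\<Delta> a)) -
        tensor_map scale (R_mult m b) id (\<Delta> a + swap (\<Delta> a))) \<longleftrightarrow> pair.compatible_right"
    unfolding pair.compatible_right_def
    by (subst on_dual) (simp_all add: zero terms algebra_simps del: uminus_apply)
  ultimately show ?thesis
    unfolding novikov_bialgebra_def using novikov conovikov by simp
qed

end

theorem corollary3p13:
  fixes smul :: "'k::field_char_0 \<Rightarrow> 'a::ab_group_add \<Rightarrow> 'a"
    and Basis :: "'a set"
    and m :: "'a \<Rightarrow> 'a \<Rightarrow> 'a"
    and \<Delta> :: "'a \<Rightarrow> ('k, 'a) tensor2"
  assumes "finite_dimensional_vector_space smul Basis"
    and "novikov_algebra smul UNIV m"
    and "novikov_coalgebra smul \<Delta>"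
  shows "((\<exists>M. manin_triple smul m (dual_mult \<Delta>) M) \<longleftrightarrow>
          matched_pair smul UNIV m dual_scale (dual smul) (dual_mult \<Delta>)
            (dual_rep (L_star m))
            (\<lambda>a f. - dual_rep (R_mult m) a f)
            (bidual_rep smul (L_star (dual_mult \<Delta>)))
            (\<lambda>f a. - bidual_rep smul (R_mult (dual_mult \<Delta>)) f a)) \<and>
         (matched_pair smul UNIV m dual_scale (dual smul) (dual_mult \<Delta>)
            (dual_rep (L_star m))
            (\<lambda>a f. - dual_rep (R_mult m) a f)
            (bidual_rep smul (L_star (dual_mult \<Delta>)))
            (\<lambda>f a. - bidual_rep smul (R_mult (dual_mult \<Delta>)) f a) \<longleftrightarrow>
          novikov_bialgebra smul m \<Delta>)"
proof -
  interpret novikov_algebra_coalgebra smul Basis m \<Delta>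
    using assms by (intro novikov_algebra_coalgebra.intro novikov_algebra_coalgebra_axioms.intro)
  show ?thesis
    using manin_triple_iff_matched_pair pair.matched_pair_iff_compatible bialgebra_iff_compatible
    by (simp only:)
qed

end
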